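(* Let $K$ be a knot and let $A$ be a triangular matrix of type II, with relevant entries $\alpha_1(m),\beta_1(m),\alpha_2(m)$, equivalent to a colouring matrix of $K$. Let $n$ be a positive integer and $m$ an integer with $\gcd(m,n)=1$, and let $Q=\mathbb{Z}_n[T,T^{-1}]/(T-m)$ be the corresponding linear finite Alexander quandle. Then the number $C_Q(K)$ of colourings of $K$ in $Q$ is $$C_Q(K)= n\times \gcd(\alpha_2(m),n)\times \gcd\!\left(\beta_1(m)\,\frac{n}{\gcd(\alpha_2(m),n)},\ \gcd(\alpha_1(m),n)\right).$$
   Context: **Linear finite Alexander quandle.** For coprime integers $n\ge 1$ and $m$, the quandle $Q=\mathbb{Z}_n[T,T^{-1}]/(T-m)$ is identified with $\mathbb{Z}_n$, with operations $a\ast b=ma+(1-m)b$ and $a\ast' b=m^{-1}a+(1-m^{-1})b$ modulo $n$. **Colourings.** Let $D$ be an oriented diagram of a knot $K$ with $N\ge1$ crossings, hence $N$ arcs. A colouring of $D$ by $Q$ assigns $X_k\in Q$ to each arc $k$ so that at each crossing with incoming under-arc $i$, outgoing under-arc $i'$ and over-arc $j$: $X_{i'}=X_i\ast X_j$ if the crossing is positive (right-handed), $X_{i'}=X_i\ast' X_j$ if it is negative (left-handed). $C_Q(K)$ is the number of colourings; it does not depend on the diagram of $K$. **Colouring matrix.** The $N\times N$ matrix over $\mathbb{Z}[m,m^{-1}]$ ($m$ regarded as an indeterminate), one row per crossing, encoding $mX_i+(1-m)X_j-X_{i'}=0$ (positive crossing) or $m^{-1}X_i+(1-m^{-1})X_j-X_{i'}=0$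 (negative crossing); if some of $i,i',j$ coincide the corresponding entries are added. The entries in each row add up to zero. The colourings by $Q$ are the solutions in $\mathbb{Z}_n$ of $AX=0$ after evaluating at the integer $m$ modulo $n$. **Equivalent matrices.** $B$ is equivalent to a colouring matrix $A$ if it is obtained from $A$ by finitely many operations of the following kinds: (a) multiplying a row by $m$, $m^{-1}$ or $-1$; (b) replacing a row by its sum with another row; (c) swapping two rows; (d) swapping two columns. **Type II.** An $N\times N$ matrix is of type II if it is upper triangular with diagonal $(1,\dots,1,\alpha_1(m),\alpha_2(m),0)$, its row $N-2$ is $(0,\dots,0,\alpha_1(m),\beta_1(m),-(\alpha_1(m)+\beta_1(m)))$, its row $N-1$ is $(0,\dots,0,\alpha_2(m),-\alpha_2(m))$, and its last row is zero (other above-diagonal entries arbitrary). In formulas, the entries are evaluated at the integer $m$ and only matter modulo $n$. *)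

theory Defs
  imports
    "HOL-Library.Poly_Mapping"
    "HOL-Library.FuncSet"
    "HOL-Combinatorics.Orbits"
    "HOL-Number_Theory.Modular_Inverse"
    "Jordan_Normal_Form.Column_Operations"
begin

section \<open>Knot diagrams\<close>

text \<open>
  An oriented knot diagram is encoded by its signed Gauss code: traversing the knot once along its
  orientation, from a point that is not a crossing, one records at each passage through a crossing
  the label of the crossing, whether the passage is the upper or the lower one, and whether the
  crossing is positive (right-handed). A code determines its diagram up to isotopy on the sphere.
  The empty code is the diagram of the unknot without crossings.
\<close>

datatype passage = Passage (label: nat) (over: bool) (positive: bool)

type_synonym gauss_code = "passage list"

definition gauss_code :: "gauss_code \<Rightarrow> bool" where
  "gauss_code D \<longleftrightarrow> distinct D \<and>
     (\<forall>c o' s. Passage c o' s \<in> set D \<longrightarrow> Passage c (\<not> o') s \<in> set D \<and> Passage c o' (\<not> s) \<notin> set D)"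

definition partner :: "gauss_code \<Rightarrow> nat \<Rightarrow> nat" where
  "partner D p = (THE q. q < length D \<and> q \<noteq> p \<and> label (D ! q) = label (D ! p))"

text \<open>
  The pair \<open>(p, d)\<close> stands for travelling towards passage \<open>p\<close> along the edge that enters it
  (\<open>d = True\<close>, following the orientation) or along the edge that leaves it (\<open>d = False\<close>, against
  the orientation). At \<open>p\<close> one turns left, onto the other strand of the crossing. At a positive
  crossing the lower strand crosses the upper one from right to left, so that a forward traveller
  turns left along the orientation of the other strand iff \<open>over = positive\<close>. The cycles of
  \<open>left_turn\<close> are the boundaries of the faces.
\<close>

definition left_turn :: "gauss_code \<Rightarrow> nat \<times> bool \<Rightarrow> nat \<times> bool" where
  "left_turn D = (\<lambda>(p, d).
     let q = partner D p; L = length D in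
     if d = (over (D ! p) = positive (D ! p)) then (Suc q mod L, True)
     else ((q + L - 1) mod L, False))"

definition faces :: "gauss_code \<Rightarrow> (nat \<times> bool) set set" where
  "faces D = orbit (left_turn D) ` ({..<length D} \<times> UNIV)"

text \<open>
  Gauss codes that do not come from a diagram on the sphere (those of virtual knots) are excluded
  by Euler's formula: with \<open>N\<close> crossings there are \<open>2 N\<close> edges (\<open>length D = 2 N\<close>), hence
  \<open>N + 2\<close> faces.
\<close>

definition planar :: "gauss_code \<Rightarrow> bool" where
  "planar D \<longleftrightarrow> D = [] \<or> 2 * card (faces D) = length D + 4"

definition knot_diagram :: "gauss_code \<Rightarrow> bool" where
  "knot_diagram D \<longleftrightarrow> gauss_code D \<and> planar D"


section \<open>Knots\<close>

definition two :: "bool \<Rightarrow> 'a \<Rightarrow> 'a \<Rightarrow> 'a list" where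
  "two f x y = (if f then [x, y] else [y, x])"

definition triangle :: "bool \<times> bool \<times> bool \<Rightarrow> bool \<Rightarrow> nat \<times> nat \<times> nat \<Rightarrow>
    gauss_code \<times> gauss_code \<times> gauss_code" where
  "triangle = (\<lambda>(t, u, v) s (a, b, c).
     let sa = (s = (t = u)); sb = (s = (t = v)); sc = (s = (u = v)) in
     (two t (Passage a True sa) (Passage b True sb),
      two u (Passage a False sa) (Passage c True sc),
      two v (Passage b False sb) (Passage c False sc)))"

text \<open>
  In \<open>triangle\<close>, \<open>a\<close> is the crossing of the top and the middle strand, \<open>b\<close> that of the top and
  the bottom strand, \<open>c\<close> that of the middle and the bottom strand. The case \<open>t = u = v = True\<close>
  is one side of the braid relation \<open>\<sigma>\<^sub>1\<sigma>\<^sub>2\<sigma>\<^sub>1 = \<sigma>\<^sub>2\<sigma>\<^sub>1\<sigma>\<^sub>2\<close> with all three crossings of sign \<open>s\<close>, and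
  \<open>t = u = v = False\<close> is the other side; reversing one strand exchanges its two passages and
  changes the signs of its two crossings. These sign patterns are exactly the ones for which the
  three segments bound a triangular face. In the second Reidemeister move, the opposite signs make
  the two new segments bound a bigon.
\<close>

inductive move :: "gauss_code \<Rightarrow> gauss_code \<Rightarrow> bool" where
  base_point: "move (D @ E) (E @ D)"
| relabel: "inj_on f (label ` set D) \<Longrightarrow>
    move D (map (\<lambda>x. Passage (f (label x)) (over x) (positive x)) D)"
| reidemeister1: "a \<notin> label ` set D \<Longrightarrow>
    move D (D @ [Passage a o' s, Passage a (\<not> o') s])"
| reidemeister2: "a \<noteq> b \<Longrightarrow> a \<notin> label ` set (D @ E) \<Longrightarrow> b \<notin> label ` set (D @ E) \<Longrightarrow>
    move (D @ E)
      (D @ [Passage a o' s, Passage b o' (\<not> s)] @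
       E @ two f (Passage a (\<not> o') s) (Passage b (\<not> o') (\<not> s)))"
| reidemeister3: "triangle (t, u, v) s (a, b, c) = (T, M, B) \<Longrightarrow>
    triangle (\<not> t, \<not> u, \<not> v) s (a, b, c) = (T', M', B') \<Longrightarrow>
    move (D @ T @ E @ M @ F @ B) (D @ T' @ E @ M' @ F @ B')"
| reidemeister3': "triangle (t, u, v) s (a, b, c) = (T, M, B) \<Longrightarrow>
    triangle (\<not> t, \<not> u, \<not> v) s (a, b, c) = (T', M', B') \<Longrightarrow>
    move (D @ T @ E @ B @ F @ M) (D @ T' @ E @ B' @ F @ M')"

definition same_knot :: "(gauss_code \<times> gauss_code) set" where
  "same_knot = {(D, E). knot_diagram D \<and> knot_diagram E \<and>
     equivclp (\<lambda>D E. knot_diagram D \<and> knot_diagram E \<and> move D E) D E}"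

text \<open>
  By Reidemeister's theorem, an oriented knot up to isotopy is an equivalence class of diagrams:
  the set of all its diagrams.
\<close>

definition knots :: "gauss_code set set" where
  "knots = {D. knot_diagram D} // same_knot"


section \<open>Crossings and arcs\<close>

text \<open>
  Crossing \<open>r\<close> is the one of the \<open>r\<close>-th lower passage, counted from \<open>0\<close>. An arc runs from one
  lower passage to the next; arc \<open>r\<close> is the one that ends at crossing \<open>r\<close>, so that the arc that
  leaves crossing \<open>r\<close> is \<open>Suc r mod N\<close>.
\<close>

definition underpasses :: "gauss_code \<Rightarrow> passage list" where
  "underpasses D = filter (\<lambda>x. \<not> over x) D"

definition num_crossings :: "gauss_code \<Rightarrow> nat" where
  "num_crossings D = length (underpasses D)"

definition crossing_positive :: "gauss_code \<Rightarrow> nat \<Rightarrow> bool" where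
  "crossing_positive D r = positive (underpasses D ! r)"

definition in_arc :: "gauss_code \<Rightarrow> nat \<Rightarrow> nat" where
  "in_arc D r = r"

definition out_arc :: "gauss_code \<Rightarrow> nat \<Rightarrow> nat" where
  "out_arc D r = Suc r mod num_crossings D"

definition over_arc :: "gauss_code \<Rightarrow> nat \<Rightarrow> nat" where
  "over_arc D r =
     length (underpasses (takeWhile (\<lambda>x. \<not> (over x \<and> label x = label (underpasses D ! r))) D))
       mod num_crossings D"

text \<open>The diagram without crossings has one arc.\<close>

definition num_arcs :: "gauss_code \<Rightarrow> nat" where
  "num_arcs D = max 1 (num_crossings D)"


section \<open>Colourings by a linear finite Alexander quandle\<close>

text \<open>
  The quandle \<open>\<int>\<^sub>n[T, T\<^sup>-\<^sup>1] / (T - m)\<close> for \<open>m\<close> coprime to \<open>n\<close>, identified with \<open>\<int>\<^sub>n = {0..<n}\<close>.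
\<close>

definition quandle_op :: "int \<Rightarrow> int \<Rightarrow> int \<Rightarrow> int \<Rightarrow> int" where
  "quandle_op n m a b = (m * a + (1 - m) * b) mod n"

definition quandle_op' :: "int \<Rightarrow> int \<Rightarrow> int \<Rightarrow> int \<Rightarrow> int" where
  "quandle_op' n m a b = (modular_inverse n m * a + (1 - modular_inverse n m) * b) mod n"

definition colourings :: "int \<Rightarrow> int \<Rightarrow> gauss_code \<Rightarrow> (nat \<Rightarrow> int) set" where
  "colourings n m D = {X \<in> {..<num_arcs D} \<rightarrow>\<^sub>E {0..<n}. \<forall>r < num_crossings D.
     X (out_arc D r) =
       (if crossing_positive D r then quandle_op n m (X (in_arc D r)) (X (over_arc D r))
        else quandle_op' n m (X (in_arc D r)) (X (over_arc D r)))}"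

text \<open>The number of colourings of a knot is the common value for all its diagrams.\<close>

definition num_colourings :: "int \<Rightarrow> int \<Rightarrow> gauss_code set \<Rightarrow> nat" where
  "num_colourings n m K = (THE k. \<forall>D \<in> K. card (colourings n m D) = k)"


section \<open>Colouring matrices\<close>

text \<open>
  The ring \<open>\<int>[m, m\<^sup>-\<^sup>1]\<close> with \<open>m\<close> an indeterminate: the group ring of \<open>\<int>\<close>, where
  \<open>Poly_Mapping.single k c\<close> is \<open>c m\<^sup>k\<close> and multiplication is convolution.
\<close>

type_synonym laurent = "int \<Rightarrow>\<^sub>0 int"

definition indet :: laurent where
  "indet = Poly_Mapping.single 1 1"

definition indet_inv :: laurent where
  "indet_inv = Poly_Mapping.single (- 1) 1"

definition power_mod :: "int \<Rightarrow> int \<Rightarrow> int \<Rightarrow> int" where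
  "power_mod n m k = (if k \<ge> 0 then m ^ nat k else modular_inverse n m ^ nat (- k))"

definition evaluate :: "int \<Rightarrow> int \<Rightarrow> laurent \<Rightarrow> int" where
  "evaluate n m p =
     (\<Sum>k \<in> Poly_Mapping.keys p. Poly_Mapping.lookup p k * power_mod n m k) mod n"

definition colouring_matrix :: "gauss_code \<Rightarrow> laurent mat" where
  "colouring_matrix D = mat (num_crossings D) (num_crossings D) (\<lambda>(r, c).
     let x = (if crossing_positive D r then indet else indet_inv) in
     (if c = in_arc D r then x else 0) + (if c = over_arc D r then 1 - x else 0) +
     (if c = out_arc D r then - 1 else 0))"

text \<open>
  Rows and columns are listed here in the order of the traversal; all other orders are reached by
  the swaps below.
\<close>

definition is_colouring_matrix :: "gauss_code set \<Rightarrow> laurent mat \<Rightarrow> bool" where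
  "is_colouring_matrix K A \<longleftrightarrow> (\<exists>D \<in> K. num_crossings D \<ge> 1 \<and> A = colouring_matrix D)"

inductive mat_step :: "laurent mat \<Rightarrow> laurent mat \<Rightarrow> bool" where
  multiply_row: "k < dim_row A \<Longrightarrow> x \<in> {indet, indet_inv, - 1} \<Longrightarrow> mat_step A (multrow k x A)"
| add_row: "k < dim_row A \<Longrightarrow> l < dim_row A \<Longrightarrow> k \<noteq> l \<Longrightarrow> mat_step A (addrow 1 k l A)"
| swap_rows: "k < dim_row A \<Longrightarrow> l < dim_row A \<Longrightarrow> mat_step A (swaprows k l A)"
| swap_cols: "k < dim_col A \<Longrightarrow> l < dim_col A \<Longrightarrow> mat_step A (swapcols k l A)"

definition equivalent_to :: "laurent mat \<Rightarrow> laurent mat \<Rightarrow> bool" where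
  "equivalent_to B A \<longleftrightarrow> mat_step\<^sup>*\<^sup>* A B"

definition type_II :: "laurent mat \<Rightarrow> laurent \<Rightarrow> laurent \<Rightarrow> laurent \<Rightarrow> bool" where
  "type_II A \<alpha>1 \<beta>1 \<alpha>2 \<longleftrightarrow> (\<exists>N \<ge> 3. A \<in> carrier_mat N N \<and> upper_triangular A \<and>
     diag_mat A = replicate (N - 3) 1 @ [\<alpha>1, \<alpha>2, 0] \<and>
     row A (N - 3) = 0\<^sub>v (N - 3) @\<^sub>v vec_of_list [\<alpha>1, \<beta>1, - (\<alpha>1 + \<beta>1)] \<and>
     row A (N - 2) = 0\<^sub>v (N - 2) @\<^sub>v vec_of_list [\<alpha>2, - \<alpha>2] \<and>
     row A (N - 1) = 0\<^sub>v N)"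

end

theory Submission
  imports Defs
begin

text \<open>
  A colouring is recorded by the colour of the edge at the base point together with the colour of
  the over-strand at each crossing: traversing the Gauss code from the base point then determines
  the colours of all edges, and the only conditions left are that each upper passage is reached
  with the recorded colour and that the traversal closes up. In this form a Reidemeister move
  changes only the colours recorded at the crossings involved, so that the number of colourings is
  an invariant for every finite quandle.

  For the linear Alexander quandle the colourings are the solutions modulo \<open>n\<close> of a linear system
  whose number of solutions is unaffected by the matrix operations. A system of type II is solved
  by back substitution: the last unknown \<open>w\<close> is free, the differences \<open>v - w\<close> and \<open>u - w\<close> of the
  two preceding ones satisfy \<open>\<alpha>\<^sub>2 (v - w) = 0\<close> and \<open>\<alpha>\<^sub>1 (u - w) + \<beta>\<^sub>1 (v - w) = 0\<close>, and all
  other unknowns are determined. The last equation has \<open>gcd \<alpha>\<^sub>1 n\<close> solutions \<open>u\<close> if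
  \<open>gcd \<alpha>\<^sub>1 n\<close> divides \<open>\<beta>\<^sub>1 (v - w)\<close>, and none otherwise.
\<close>

section \<open>Gauss codes\<close>

text \<open>Each of the two passages of a crossing excludes the other sign at its own level, so all
  passages with one label share a sign; only the level can then differ.\<close>

lemma gauss_code_label_twice:
  assumes D: "gauss_code D" and p: "p \<in> set D" and q: "q \<in> set D" "label q = label p"
  shows "q = p \<or> q = Passage (label p) (\<not> over p) (positive p)"
proof -
  have mem: "Passage (label p) (over p) (positive p) \<in> set D"
    "Passage (label p) (over q) (positive q) \<in> set D"
    using p q by (metis passage.collapse)+
  have D': "Passage l (\<not> o') s \<in> set D" "Passage l o' (\<not> s) \<notin> set D" "Passage l (\<not> o') (\<not> s) \<notin> set D"
    if "Passage l o' s \<in> set D" for l o' s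
    using D that by (auto simp: gauss_code_def)
  have "positive q = positive p"
    using D'[OF mem(1)] mem(2) by (cases "over q"; cases "over p"; cases "positive q"; cases "positive p") auto
  then show ?thesis
    using q by (cases p; cases q) auto
qed

lemma triangle_labels:
  assumes "triangle (t, u, v) s (a, b, c) = (T, M, B)"
  shows "label ` set T = {a, b}" "label ` set M = {a, c}" "label ` set B = {b, c}"
  using assms by (cases t; cases u; cases v; auto simp: triangle_def two_def Let_def)+

text \<open>Isolates the crossing \<open>c\<close>, so that the colour recorded there can be changed
  locally. A coincidence with \<open>a\<close> or \<open>b\<close> would produce a second upper
  passage labelled \<open>c\<close>, and the two passages of \<open>c\<close> already lie in
  \<open>M\<close> and \<open>B\<close>, so none is left for \<open>R\<close>.\<close>

lemma gauss_code_triangle: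
  assumes T: "triangle (t, u, v) s (a, b, c) = (T, M, B)"
    and D: "gauss_code D" "mset D = mset (T @ M @ B @ R)"
  shows "a \<noteq> c" "b \<noteq> c" "c \<notin> label ` set R"
proof -
  define sa sb sc where "sa = (s = (t = u))" and "sb = (s = (t = v))" and "sc = (s = (u = v))"
  have TMB: "mset T = {#Passage a True sa, Passage b True sb#}"
    "mset M = {#Passage a False sa, Passage c True sc#}"
    "mset B = {#Passage b False sb, Passage c False sc#}"
    using T by (auto simp: triangle_def two_def Let_def sa_def sb_def sc_def)
  have mset: "mset D = mset ([Passage a True sa, Passage b True sb, Passage a False sa,
      Passage c True sc, Passage b False sb, Passage c False sc] @ R)"
    by (simp add: D(2) TMB)
  have set: "set D = {Passage a True sa, Passage b True sb, Passage a False sa,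
      Passage c True sc, Passage b False sb, Passage c False sc} \<union> set R"
    using mset_eq_setD[OF mset] by auto
  have dist: "distinct ([Passage a True sa, Passage b True sb, Passage a False sa,
      Passage c True sc, Passage b False sb, Passage c False sc] @ R)"
    using D(1) mset_eq_imp_distinct_iff[OF mset] by (auto simp: gauss_code_def)
  note twice = gauss_code_label_twice[OF D(1), of "Passage c True sc"]
  show "a \<noteq> c"
    using twice[of "Passage a True sa"] dist by (auto simp: set)
  show "b \<noteq> c"
    using twice[of "Passage b True sb"] dist by (auto simp: set)
  show "c \<notin> label ` set R"
    using twice dist by (fastforce simp: set)
qed

text \<open>The arc that runs over the crossing labelled \<open>a\<close>, numbered by the lower
  passages met before. The remainder identifies the stretch after the last lower passage with arc 0,
  since both belong to the arc through the base point.\<close>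

definition arc_of_label :: "gauss_code \<Rightarrow> nat \<Rightarrow> nat" where
  "arc_of_label D a =
     num_crossings (takeWhile (\<lambda>x. \<not> (over x \<and> label x = a)) D) mod num_crossings D"

lemma over_arc_eq_arc_of_label: "over_arc D r = arc_of_label D (label (underpasses D ! r))"
  by (simp add: over_arc_def arc_of_label_def num_crossings_def)

lemma num_crossings_simps [simp]:
  "num_crossings [] = 0"
  "num_crossings (p # D) = (if over p then num_crossings D else Suc (num_crossings D))"
  "num_crossings (D @ E) = num_crossings D + num_crossings E"
  by (simp_all add: num_crossings_def underpasses_def)

lemma underpasses_nth_append:
  "\<not> over p \<Longrightarrow> underpasses (E @ p # F) ! num_crossings E = p"
  by (simp add: underpasses_def num_crossings_def nth_append)

lemma underpass_splitE:
  assumes "r < num_crossings D"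
  obtains E p F where "D = E @ p # F" "\<not> over p" "num_crossings E = r"
  using assms
proof (induction D arbitrary: r thesis)
  case (Cons q D)
  show ?case
  proof (cases "over q \<or> r > 0")
    case True
    then obtain E p F where "D = E @ p # F" "\<not> over p"
      "num_crossings E = (if over q then r else r - 1)"
      using Cons.prems(2) by (cases "over q") (auto intro: Cons.IH[of r] Cons.IH[of "r - 1"])
    then show ?thesis
      using True by (intro Cons.prems(1)[of "q # E"]) auto
  next
    case False
    then show ?thesis
      by (intro Cons.prems(1)[of "[]"]) auto
  qed
qed auto

text \<open>A Gauss code has only one upper passage with a given label, so the
  \<open>takeWhile\<close> stops exactly at \<open>p\<close>.\<close>

lemma arc_of_label_append:
  assumes "gauss_code (E @ p # F)" "over p"
  shows "arc_of_label (E @ p # F) (label p) = num_crossings E mod num_crossings (E @ p # F)"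
proof -
  have "\<not> (over x \<and> label x = label p)" if "x \<in> set E" for x
    using gauss_code_label_twice[OF assms(1), of p x] that assms by (auto simp: gauss_code_def)
  then have "takeWhile (\<lambda>x. \<not> (over x \<and> label x = label p)) (E @ p # F) = E"
    using assms(2) by (subst takeWhile_append2) auto
  then show ?thesis
    by (simp only: arc_of_label_def)
qed

lemma gauss_code_passage:
  assumes "gauss_code D" "p \<in> set D"
  shows "Passage (label p) o' (positive p) \<in> set D"
  using assms by (cases p; cases "o' = over p") (auto simp: gauss_code_def)

lemma overpass_splitE:
  assumes "gauss_code D" "a \<in> label ` set D"
  obtains E p F where "D = E @ p # F" "over p" "label p = a"
proof -
  obtain q where q: "q \<in> set D" "a = label q"
    using assms by auto
  then have "\<exists>p\<in>set D. over p \<and> label p = a"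
    using gauss_code_passage[OF assms(1) q(1), of True] q(2)
    by (intro bexI[of _ "Passage (label q) True (positive q)"]) auto
  then show ?thesis
    using that by (metis split_list)
qed

lemma num_crossings_pos:
  assumes "gauss_code D" "D \<noteq> []"
  shows "num_crossings D > 0"
proof -
  obtain q where "q \<in> set D"
    using assms by (cases D) auto
  then have "\<exists>p\<in>set D. \<not> over p"
    using gauss_code_passage[OF assms(1), of q False] by force
  then show ?thesis
    by (auto simp: num_crossings_def underpasses_def filter_empty_conv)
qed

section \<open>Colourings by a finite quandle\<close>

text \<open>The Boolean is the sign of the crossing: \<open>op True\<close> is the quandle operation
  and \<open>op False\<close> its inverse. Distributivity is stated for two independent signs
  because the crossings of a third Reidemeister move may differ in sign.\<close>

locale finite_quandle =
  fixes S :: "'a set" and op :: "bool \<Rightarrow> 'a \<Rightarrow> 'a \<Rightarrow> 'a"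
  assumes finite_carrier: "finite S"
    and op_closed: "x \<in> S \<Longrightarrow> y \<in> S \<Longrightarrow> op s x y \<in> S"
    and op_idem: "x \<in> S \<Longrightarrow> op s x x = x"
    and op_inverse: "x \<in> S \<Longrightarrow> y \<in> S \<Longrightarrow> op (\<not> s) (op s x y) y = x"
    and op_distrib: "x \<in> S \<Longrightarrow> y \<in> S \<Longrightarrow> z \<in> S \<Longrightarrow>
      op s (op s' x y) z = op s' (op s x z) (op s y z)"
begin

lemma op_inverse':
  assumes "x \<in> S" "y \<in> S"
  shows "op True (op False x y) y = x" "op False (op True x y) y = x"
  using op_inverse[OF assms, of True] op_inverse[OF assms, of False] by simp_all

primrec exit_colour :: "(nat \<Rightarrow> 'a) \<Rightarrow> 'a \<Rightarrow> gauss_code \<Rightarrow> 'a" where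
  "exit_colour f x [] = x"
| "exit_colour f x (p # D) =
     exit_colour f (if over p then x else op (positive p) x (f (label p))) D"

primrec consistent :: "(nat \<Rightarrow> 'a) \<Rightarrow> 'a \<Rightarrow> gauss_code \<Rightarrow> bool" where
  "consistent f x [] \<longleftrightarrow> True"
| "consistent f x (p # D) \<longleftrightarrow> (over p \<longrightarrow> f (label p) = x) \<and>
     consistent f (if over p then x else op (positive p) x (f (label p))) D"

definition edge_colourings :: "gauss_code \<Rightarrow> ('a \<times> (nat \<Rightarrow> 'a)) set" where
  "edge_colourings D = {(x, f). x \<in> S \<and> f \<in> label ` set D \<rightarrow>\<^sub>E S \<and>
     consistent f x D \<and> exit_colour f x D = x}"

lemma exit_colour_append [simp]:
  "exit_colour f x (D @ E) = exit_colour f (exit_colour f x D) E"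
  by (induction D arbitrary: x) auto

lemma consistent_append [simp]:
  "consistent f x (D @ E) \<longleftrightarrow> consistent f x D \<and> consistent f (exit_colour f x D) E"
  by (induction D arbitrary: x) auto

lemma exit_colour_cong:
  "(\<And>a. a \<in> label ` set D \<Longrightarrow> f a = g a) \<Longrightarrow> exit_colour f x D = exit_colour g x D"
  by (induction D arbitrary: x) auto

lemma consistent_cong:
  "(\<And>a. a \<in> label ` set D \<Longrightarrow> f a = g a) \<Longrightarrow> consistent f x D = consistent g x D"
  by (induction D arbitrary: x) auto

lemma exit_colour_closed:
  "x \<in> S \<Longrightarrow> f ` label ` set D \<subseteq> S \<Longrightarrow> exit_colour f x D \<in> S"
  by (induction D arbitrary: x) (auto simp: op_closed)

lemma exit_colour_fun_upd [simp]:
  "a \<notin> label ` set D \<Longrightarrow> exit_colour (f(a := y)) x D = exit_colour f x D"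
  by (rule exit_colour_cong) auto

lemma consistent_fun_upd [simp]:
  "a \<notin> label ` set D \<Longrightarrow> consistent (f(a := y)) x D = consistent f x D"
  by (rule consistent_cong) auto

lemma exit_colour_restrict [simp]:
  "label ` set D \<subseteq> L \<Longrightarrow> exit_colour (restrict f L) x D = exit_colour f x D"
  by (rule exit_colour_cong) auto

lemma consistent_restrict [simp]:
  "label ` set D \<subseteq> L \<Longrightarrow> consistent (restrict f L) x D = consistent f x D"
  by (rule consistent_cong) auto

section \<open>Invariance of the number of edge colourings under the moves\<close>

lemma card_edge_colourings_base_point:
  "card (edge_colourings (D @ E)) = card (edge_colourings (E @ D))"
proof (rule bij_betw_same_card)
  \<comment> \<open>The recorded colours stay; the base colour is transported through
    \<open>D\<close>. Transporting it further through \<open>E\<close> returns to the start because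
    the traversal closes up.\<close>
  show "bij_betw (\<lambda>(x, f). (exit_colour f x D, f)) (edge_colourings (D @ E)) (edge_colourings (E @ D))"
    by (rule bij_betw_byWitness[where f' = "\<lambda>(x, f). (exit_colour f x E, f)"])
      (auto simp: edge_colourings_def Un_commute intro!: exit_colour_closed)
qed

lemma exit_colour_relabel:
  "exit_colour f x (map (\<lambda>p. Passage (g (label p)) (over p) (positive p)) D) =
   exit_colour (f \<circ> g) x D"
  by (induction D arbitrary: x) auto

lemma consistent_relabel:
  "consistent f x (map (\<lambda>p. Passage (g (label p)) (over p) (positive p)) D) =
   consistent (f \<circ> g) x D"
  by (induction D arbitrary: x) auto

lemma card_edge_colourings_relabel:
  assumes "inj_on g (label ` set D)"
  shows "card (edge_colourings (map (\<lambda>p. Passage (g (label p)) (over p) (positive p)) D)) =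
    card (edge_colourings D)" (is "card (edge_colourings ?E) = _")
proof (rule bij_betw_same_card)
  define L where "L = label ` set D"
  \<comment> \<open>\<open>g\<close> is injective only on the labels that occur, so its inverse is
    taken there.\<close>
  define h where "h = inv_into L g"
  have mem: "(x, f) \<in> edge_colourings ?E \<longleftrightarrow> x \<in> S \<and> f \<in> g ` L \<rightarrow>\<^sub>E S \<and>
      consistent (f \<circ> g) x D \<and> exit_colour (f \<circ> g) x D = x" for x f
    by (auto simp: edge_colourings_def exit_colour_relabel consistent_relabel L_def image_image)
  have mem': "(x, f) \<in> edge_colourings D \<longleftrightarrow> x \<in> S \<and> f \<in> L \<rightarrow>\<^sub>E S \<and>
      consistent f x D \<and> exit_colour f x D = x" for x f
    by (auto simp: edge_colourings_def L_def)
  have hg: "h (g a) = a" if "a \<in> L" for a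
    using assms that unfolding h_def L_def by (rule inv_into_f_f)
  have up: "exit_colour (restrict (f \<circ> h) (g ` L) \<circ> g) x D = exit_colour f x D"
    "consistent (restrict (f \<circ> h) (g ` L) \<circ> g) x D = consistent f x D" for f x
    by (rule exit_colour_cong consistent_cong; simp add: hg flip: L_def)+
  have down: "exit_colour (restrict (f \<circ> g) L) x D = exit_colour (f \<circ> g) x D"
    "consistent (restrict (f \<circ> g) L) x D = consistent (f \<circ> g) x D" for f x
    by (simp_all add: L_def)
  show "bij_betw (\<lambda>(x, f). (x, restrict (f \<circ> g) L)) (edge_colourings ?E) (edge_colourings D)"
    by (rule bij_betw_byWitness[where f' = "\<lambda>(x, f). (x, restrict (f \<circ> h) (g ` L))"])
      (auto simp: mem mem' up down hg PiE_iff extensional_def fun_eq_iff)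
qed

lemma card_edge_colourings_reidemeister1:
  assumes "a \<notin> label ` set D"
  shows "card (edge_colourings (D @ [Passage a o' s, Passage a (\<not> o') s])) =
    card (edge_colourings D)" (is "card (edge_colourings ?E) = _")
proof (rule bij_betw_same_card[symmetric])
  define L where "L = label ` set D"
  have L: "a \<notin> L" "label ` set ?E = insert a L" using assms by (auto simp: L_def)
  have z: "exit_colour f x D \<in> S" if "x \<in> S" "f \<in> insert a L \<rightarrow>\<^sub>E S" for f x
    using that by (auto simp: L_def intro!: exit_colour_closed)
  \<comment> \<open>At the kink the strand passes under itself. With the upper passage first,
    idempotence makes the lower one harmless; with the lower passage first,
    \<open>op s y (f a) = f a\<close> forces \<open>y = f a\<close> by inverting the operation and
    idempotence. The kink ends the word, where the strand is back at the base colour, hence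
    \<open>f a = x\<close>.\<close>
  have iff: "consistent f x ?E \<and> exit_colour f x ?E = x \<longleftrightarrow>
      consistent f x D \<and> exit_colour f x D = x \<and> f a = x"
    if "x \<in> S" "f \<in> insert a L \<rightarrow>\<^sub>E S" for f x
  proof -
    have S: "exit_colour f x D \<in> S" "f a \<in> S" using z[OF that] that by auto
    show ?thesis
      by (cases o'; simp; metis S op_idem op_inverse)
  qed
  have mem: "(x, f) \<in> edge_colourings ?E \<longleftrightarrow> x \<in> S \<and> f \<in> insert a L \<rightarrow>\<^sub>E S \<and>
      consistent f x D \<and> exit_colour f x D = x \<and> f a = x" for x f
    using iff[of x f] L by (auto simp only: edge_colourings_def mem_Collect_eq prod.case)
  have mem': "(x, f) \<in> edge_colourings D \<longleftrightarrow> x \<in> S \<and> f \<in> L \<rightarrow>\<^sub>E S \<and>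
      consistent f x D \<and> exit_colour f x D = x" for x f
    by (auto simp: edge_colourings_def L_def)
  show "bij_betw (\<lambda>(x, f). (x, f(a := x))) (edge_colourings D) (edge_colourings ?E)"
    by (rule bij_betw_byWitness[where f' = "\<lambda>(x, f). (x, restrict f L)"])
      (use L(1) assms in \<open>auto simp: mem mem' L_def PiE_iff extensional_def fun_eq_iff\<close>)
qed

lemma card_edge_colourings_reidemeister2:
  assumes ab: "a \<noteq> b" and a: "a \<notin> label ` set (D @ E)" and b: "b \<notin> label ` set (D @ E)"
  shows "card (edge_colourings (D @ [Passage a o' s, Passage b o' (\<not> s)] @
       E @ two t (Passage a (\<not> o') s) (Passage b (\<not> o') (\<not> s)))) =
    card (edge_colourings (D @ E))" (is "card (edge_colourings ?E) = _")
proof (rule bij_betw_same_card[symmetric])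
  define L where "L = label ` set (D @ E)"
  \<comment> \<open>The colour of the upper strand at the two new crossings. If the first segment is
    the upper one, it is reached after \<open>D\<close>; otherwise the upper segment ends the word
    and has the base colour, as the traversal closes up.\<close>
  define w where "w f x = (if o' then exit_colour f x D else x)" for f x
  have L: "a \<notin> L" "b \<notin> L" "label ` set ?E = insert a (insert b L)"
    using assms by (auto simp: L_def two_def)
  have z: "exit_colour f x D \<in> S" "exit_colour f y E \<in> S"
    if "x \<in> S" "y \<in> S" "f \<in> insert a (insert b L) \<rightarrow>\<^sub>E S" for f x y
    using that by (auto simp: L_def intro!: exit_colour_closed)
  have iff: "consistent f x ?E \<and> exit_colour f x ?E = x \<longleftrightarrow>
      consistent f x (D @ E) \<and> exit_colour f x (D @ E) = x \<and> f a = w f x \<and> f b = w f x"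
    if f: "x \<in> S" "f \<in> insert a (insert b L) \<rightarrow>\<^sub>E S" for f x
  proof -
    define z where "z = exit_colour f x D"
    define y where "y = exit_colour f z E"
    have S: "f a \<in> S" "f b \<in> S" "z \<in> S" "y \<in> S"
      using f z by (auto simp: z_def y_def)
    let ?P = "[Passage a o' s, Passage b o' (\<not> s)]"
    let ?Q = "two t (Passage a (\<not> o') s) (Passage b (\<not> o') (\<not> s))"
    show ?thesis
    \<comment> \<open>With equal recorded colours, the two lower passages have opposite signs and
      undo each other. Unequal ones cannot occur: the two upper passages are consecutive, so
      consistency records the same colour at both.\<close>
    proof (cases "f b = f a")
      case True
      have P: "exit_colour f z ?P = z" "consistent f z ?P \<longleftrightarrow> (o' \<longrightarrow> f a = z)"
        using S True op_inverse by auto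
      have Q: "exit_colour f y ?Q = y" "consistent f y ?Q \<longleftrightarrow> (\<not> o' \<longrightarrow> f a = y)"
        using S True by (cases s; auto simp: two_def op_inverse')+
      show ?thesis
        unfolding w_def exit_colour_append consistent_append z_def[symmetric] P y_def[symmetric] Q
        using True by auto
    next
      case False
      have "\<not> consistent f x ?E"
        using False by (cases o') (auto simp: two_def)
      then show ?thesis
        using False by auto
    qed
  qed
  have mem: "(x, f) \<in> edge_colourings ?E \<longleftrightarrow> x \<in> S \<and> f \<in> insert a (insert b L) \<rightarrow>\<^sub>E S \<and>
      consistent f x (D @ E) \<and> exit_colour f x (D @ E) = x \<and> f a = w f x \<and> f b = w f x" for x f
    using iff[of x f] L by (auto simp only: edge_colourings_def mem_Collect_eq prod.case)
  have mem': "(x, f) \<in> edge_colourings (D @ E) \<longleftrightarrow> x \<in> S \<and> f \<in> L \<rightarrow>\<^sub>E S \<and>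
      consistent f x (D @ E) \<and> exit_colour f x (D @ E) = x" for x f
    by (auto simp: edge_colourings_def L_def)
  have wS: "w f x \<in> S" if "x \<in> S" "f \<in> L \<rightarrow>\<^sub>E S" for f x
    using that unfolding w_def by (auto simp: L_def intro!: exit_colour_closed)
  have w_cong: "w (f(a := y, b := y')) x = w f x" "w (restrict f L) x = w f x" for f x y y'
    using a b by (auto simp: w_def L_def image_Un)
  have upd: "exit_colour (f(a := y, b := y)) x (D @ E) = exit_colour f x (D @ E)"
    "consistent (f(a := y, b := y)) x (D @ E) = consistent f x (D @ E)"
    "exit_colour (restrict f L) x (D @ E) = exit_colour f x (D @ E)"
    "consistent (restrict f L) x (D @ E) = consistent f x (D @ E)" for f x y
    using a b by (auto simp: L_def simp del: exit_colour_append consistent_append)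
  define W where "W = ?E"
  show "bij_betw (\<lambda>(x, f). (x, f(a := w f x, b := w f x)))
      (edge_colourings (D @ E)) (edge_colourings ?E)"
    unfolding W_def[symmetric]
    by (rule bij_betw_byWitness[where f' = "\<lambda>(x, f). (x, restrict f L)"])
      (use L(1,2) wS in \<open>auto simp: mem[folded W_def] mem' upd w_cong PiE_iff extensional_def fun_eq_iff
        simp del: exit_colour_append consistent_append\<close>)
qed

text \<open>
  The move slides crossing \<open>c\<close> from one side of the top strand to the other, so the middle strand
  now meets \<open>c\<close> before instead of after passing under \<open>f a\<close> (or vice versa): \<open>u\<close> tells which, and
  the colour recorded at \<open>c\<close> changes by one quandle operation with \<open>f a\<close>.
\<close>

lemma triangle_colouring:
  assumes T: "triangle (t, u, v) s (a, b, c) = (T, M, B)"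
    and T': "triangle (\<not> t, \<not> u, \<not> v) s (a, b, c) = (T', M', B')"
    and ne: "a \<noteq> c" "b \<noteq> c"
    and f: "f a \<in> S" "f b = f a" "f c \<in> S" and y: "y \<in> S"
    and g: "g = f(c := op ((s = (t = u)) \<noteq> u) (f c) (f a))"
  shows "consistent g y T' = consistent f y T" "exit_colour g y T' = exit_colour f y T"
    "consistent g y M' = consistent f y M" "exit_colour g y M' = exit_colour f y M"
    "consistent g y B' = consistent f y B" "exit_colour g y B' = exit_colour f y B"
proof -
  define sa sb sc where "sa = (s = (t = u))" and "sb = (s = (t = v))" and "sc = (s = (u = v))"
  have segments:
    "T = two t (Passage a True sa) (Passage b True sb)"
    "M = two u (Passage a False sa) (Passage c True sc)"
    "B = two v (Passage b False sb) (Passage c False sc)"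
    "T' = two (\<not> t) (Passage a True sa) (Passage b True sb)"
    "M' = two (\<not> u) (Passage a False sa) (Passage c True sc)"
    "B' = two (\<not> v) (Passage b False sb) (Passage c False sc)"
    using T T' by (auto simp: triangle_def Let_def sa_def sb_def sc_def)
  have g: "g = f(c := op (sa \<noteq> u) (f c) (f a))"
    using g by (simp add: sa_def)
  have inv: "op p (op (\<not> p) z (f a)) (f a) = z" if "z \<in> S" for p z
    using op_inverse[OF that f(1), of "\<not> p"] by simp
  \<comment> \<open>Operating by \<open>f a\<close> is invertible, so it can be moved across an
    equation with the opposite sign or cancelled on both sides. These are the two forms in which the
    condition at the upper passage of \<open>c\<close> changes, according to whether the middle
    strand met \<open>c\<close> after or before passing under the top strand.\<close>
  have M: "op p (f c) (f a) = y \<longleftrightarrow> f c = op (\<not> p) y (f a)" for p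
    using f y inv op_inverse[of _ "f a" p] by metis
  have M': "op p (f c) (f a) = op p y (f a) \<longleftrightarrow> f c = y" for p
    using f y by (metis op_inverse)
  note simps = segments two_def f(2) g
  show "consistent g y T' = consistent f y T" "exit_colour g y T' = exit_colour f y T"
    using ne by (auto simp: simps)
  show "consistent g y M' = consistent f y M"
    using ne M[of sa] M[of "\<not> sa"] M'[of sa] by (auto simp: simps)
  show "exit_colour g y M' = exit_colour f y M"
    using ne by (auto simp: simps)
  show "consistent g y B' = consistent f y B"
    by (simp add: simps)
  \<comment> \<open>The bottom strand passes under both others, in exchanged order: this is
    self-distributivity. The sign used to update the colour at \<open>c\<close> equals
    \<open>sb\<close> or its negation according to \<open>v\<close>, so the colour of the middle
    strand is transported by \<open>f a\<close> in the direction that the law requires.\<close>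
  show "exit_colour g y B' = exit_colour f y B"
  proof (cases v)
    case True
    then have "(sa \<noteq> u) = (\<not> sb)" by (auto simp: sa_def sb_def)
    then show ?thesis
      using True ne f y op_distrib[of y "op (\<not> sb) (f c) (f a)" "f a" sb sc]
      by (simp add: simps op_closed inv)
  next
    case False
    then have "(sa \<noteq> u) = sb" by (auto simp: sa_def sb_def)
    then show ?thesis
      using False ne f y by (simp add: simps op_distrib[where z = "f a"] op_closed)
  qed
qed

text \<open>\<open>YZ\<close> covers both orders in which the traversal can meet the middle and the
  bottom strand. Each of the three segments keeps its exit colour and its consistency, and the rest
  of the code does not see the colour at \<open>c\<close>, so the whole traversal is
  unaffected.\<close>

lemma edge_colourings_triangle:
  assumes T: "triangle (t, u, v) s (a, b, c) = (T, M, B)"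
    and T': "triangle (\<not> t, \<not> u, \<not> v) s (a, b, c) = (T', M', B')"
    and YZ: "(Y, Z, Y', Z') = (M, B, M', B') \<or> (Y, Z, Y', Z') = (B, M, B', M')"
    and ne: "a \<noteq> c" "b \<noteq> c" and c: "c \<notin> label ` set (D @ E @ F)"
    and f: "(x, f) \<in> edge_colourings (D @ T @ E @ Y @ F @ Z)"
  shows "(x, f(c := op ((s = (t = u)) \<noteq> u) (f c) (f a))) \<in>
    edge_colourings (D @ T' @ E @ Y' @ F @ Z')"
proof -
  define W where "W = D @ T @ E @ Y @ F @ Z"
  define g where "g = f(c := op ((s = (t = u)) \<noteq> u) (f c) (f a))"
  note labels = triangle_labels[OF T] triangle_labels[OF T']
  have yz: "label ` set Y \<union> label ` set Z = {a, b, c}" "label ` set Y' \<union> label ` set Z' = {a, b, c}"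
    by (rule disjE[OF YZ]; clarify; unfold labels; blast)+
  have union: "U \<union> ({a, b} \<union> (U' \<union> (P \<union> (U'' \<union> Q)))) = {a, b, c} \<union> (U \<union> (U' \<union> U''))"
    if "P \<union> Q = {a, b, c}" for P Q U U' U'' :: "nat set"
    using that by blast
  have W: "label ` set W = {a, b, c} \<union> label ` set (D @ E @ F)"
    "label ` set (D @ T' @ E @ Y' @ F @ Z') = label ` set W"
    unfolding W_def set_append image_Un labels union[OF yz(1)] union[OF yz(2)] by (rule refl)+
  have x: "x \<in> S" and fS: "f \<in> label ` set W \<rightarrow>\<^sub>E S"
    and cons: "consistent f x W" and ex: "exit_colour f x W = x"
    using f by (auto simp: edge_colourings_def W_def)
  have f_mem: "f a \<in> S" "f b \<in> S" "f c \<in> S"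
    using fS W by auto
  \<comment> \<open>Both passages of the top segment are upper, so no colour change occurs between
    them.\<close>
  have f_eq: "f b = f a"
    using cons T by (auto simp: W_def triangle_def two_def Let_def split: if_splits)
  have cl: "exit_colour f y V \<in> S" if "y \<in> S" "V \<in> {D, T, E, Y, F}" for y V
    using that fS by (intro exit_colour_closed) (auto simp: W_def)
  have V: "exit_colour g y V = exit_colour f y V" "consistent g y V = consistent f y V"
    if "V \<in> {D, E, F}" for y V
    using that c by (auto simp: g_def image_Un)
  note tri = triangle_colouring[OF T T' ne f_mem(1) f_eq f_mem(3) _ g_def]
  have YZ_tri: "exit_colour g y Y' = exit_colour f y Y" "consistent g y Y' = consistent f y Y"
    "exit_colour g y Z' = exit_colour f y Z" "consistent g y Z' = consistent f y Z" if "y \<in> S" for y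
    using YZ tri that by auto
  have "consistent g x (D @ T' @ E @ Y' @ F @ Z') = consistent f x W"
    "exit_colour g x (D @ T' @ E @ Y' @ F @ Z') = exit_colour f x W"
    by (simp_all add: W_def V tri YZ_tri cl x)
  moreover have "g \<in> label ` set W \<rightarrow>\<^sub>E S"
    using fS f_mem W by (auto simp: g_def PiE_iff extensional_def op_closed)
  ultimately show ?thesis
    unfolding edge_colourings_def W(2) g_def[symmetric] using x cons ex by simp
qed

text \<open>The reverse move is again a triangle move, with \<open>t\<close>, \<open>u\<close>,
  \<open>v\<close> negated. This negates the sign of the update at \<open>c\<close>, so the two maps
  are mutually inverse.\<close>

lemma card_edge_colourings_triangle:
  assumes T: "triangle (t, u, v) s (a, b, c) = (T, M, B)"
    and T': "triangle (\<not> t, \<not> u, \<not> v) s (a, b, c) = (T', M', B')"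
    and YZ: "(Y, Z, Y', Z') = (M, B, M', B') \<or> (Y, Z, Y', Z') = (B, M, B', M')"
    and ne: "a \<noteq> c" "b \<noteq> c" and c: "c \<notin> label ` set (D @ E @ F)"
  shows "card (edge_colourings (D @ T @ E @ Y @ F @ Z)) =
    card (edge_colourings (D @ T' @ E @ Y' @ F @ Z'))" (is "card ?C = card ?C'")
proof (rule bij_betw_same_card)
  define p where "p = ((s = (t = u)) \<noteq> u)"
  define h where "h q f = f(c := op q (f c) (f a))" for q and f :: "nat \<Rightarrow> 'a"
  have np: "((s = ((\<not> t) = (\<not> u))) \<noteq> (\<not> u)) = (\<not> p)"
    by (auto simp: p_def)
  have fwd: "(x, h p f) \<in> ?C'" if "(x, f) \<in> ?C" for x f
    using edge_colourings_triangle[OF T T' YZ ne c that] by (simp add: h_def p_def)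
  have YZ': "(Y', Z', Y, Z) = (M', B', M, B) \<or> (Y', Z', Y, Z) = (B', M', B, M)"
    using YZ by auto
  have bwd: "(x, h (\<not> p) f) \<in> ?C" if "(x, f) \<in> ?C'" for x f
    using edge_colourings_triangle[OF T' _ YZ' ne c that] T unfolding h_def np by simp
  have mem: "f a \<in> S" "f c \<in> S" if "(x, f) \<in> ?C \<or> (x, f) \<in> ?C'" for x f
    using that YZ
    by (auto simp: edge_colourings_def image_Un triangle_labels[OF T] triangle_labels[OF T'] PiE_iff)
  have inv: "h (\<not> q) (h q f) = f" "h q (h (\<not> q) f) = f"
    if "(x, f) \<in> ?C \<or> (x, f) \<in> ?C'" for q x f
    using mem[OF that] ne op_inverse[of "f c" "f a" q] op_inverse[of "f c" "f a" "\<not> q"]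
    by (simp_all add: h_def)
  show "bij_betw (\<lambda>(x, f). (x, h p f)) ?C ?C'"
  proof (rule bij_betw_byWitness[where f' = "\<lambda>(x, f). (x, h (\<not> p) f)"])
    show "\<forall>z\<in>?C. (case case z of (x, f) \<Rightarrow> (x, h p f) of (x, f) \<Rightarrow> (x, h (\<not> p) f)) = z"
      using inv(1)[OF disjI1] by (clarsimp simp only: prod.case simp_thms)
    show "\<forall>z\<in>?C'. (case case z of (x, f) \<Rightarrow> (x, h (\<not> p) f) of (x, f) \<Rightarrow> (x, h p f)) = z"
      using inv(2)[OF disjI2] by (clarsimp simp only: prod.case simp_thms)
    show "(\<lambda>(x, f). (x, h p f)) ` ?C \<subseteq> ?C'"
      using fwd by (clarsimp simp only: prod.case simp_thms)
    show "(\<lambda>(x, f). (x, h (\<not> p) f)) ` ?C' \<subseteq> ?C"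
      using bwd by (clarsimp simp only: prod.case simp_thms)
  qed
qed

lemma card_edge_colourings_move:
  assumes "move D E" "gauss_code D"
  shows "card (edge_colourings D) = card (edge_colourings E)"
  using assms
proof cases
  case (base_point D E)
  then show ?thesis by (simp add: card_edge_colourings_base_point)
next
  case (relabel f)
  then show ?thesis by (simp add: card_edge_colourings_relabel)
next
  case (reidemeister1 a o' s)
  then show ?thesis by (simp add: card_edge_colourings_reidemeister1)
next
  case (reidemeister2 a b X Y o' s t)
  show ?thesis
    unfolding reidemeister2(1,2) by (rule card_edge_colourings_reidemeister2[OF reidemeister2(3-5), symmetric])
next
  case (reidemeister3 t u v s a b c T M B T' M' B' X Y Z)
  show ?thesis
    unfolding reidemeister3(1,2)
    by (rule card_edge_colourings_triangle[OF reidemeister3(3,4)];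
      use gauss_code_triangle[OF reidemeister3(3) assms(2), of "X @ Y @ Z"] reidemeister3(1) in simp)
next
  case (reidemeister3' t u v s a b c T M B T' M' B' X Y Z)
  show ?thesis
    unfolding reidemeister3'(1,2)
    by (rule card_edge_colourings_triangle[OF reidemeister3'(3,4)];
      use gauss_code_triangle[OF reidemeister3'(3) assms(2), of "X @ Y @ Z"] reidemeister3'(1) in simp)
qed

section \<open>Edge colourings and arc colourings correspond\<close>

definition arc_colourings :: "gauss_code \<Rightarrow> (nat \<Rightarrow> 'a) set" where
  "arc_colourings D = {X \<in> {..<num_arcs D} \<rightarrow>\<^sub>E S. \<forall>r < num_crossings D.
     X (out_arc D r) = op (crossing_positive D r) (X (in_arc D r)) (X (over_arc D r))}"

text \<open>The colours with which the lower passages are reached. As arc \<open>r\<close> ends at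
  crossing \<open>r\<close>, these are the colours of the arcs in order.\<close>

primrec under_colours :: "(nat \<Rightarrow> 'a) \<Rightarrow> 'a \<Rightarrow> gauss_code \<Rightarrow> 'a list" where
  "under_colours f x [] = []"
| "under_colours f x (p # D) =
     (if over p then under_colours f x D
      else x # under_colours f (op (positive p) x (f (label p))) D)"

lemma under_colours_append:
  "under_colours f x (D @ E) = under_colours f x D @ under_colours f (exit_colour f x D) E"
  by (induction D arbitrary: x) auto

lemma length_under_colours: "length (under_colours f x D) = num_crossings D"
  by (induction D arbitrary: x) auto

text \<open>The appended exit colour covers words without lower passages, along which the colour
  does not change.\<close>

lemma hd_under_colours: "(under_colours f x D @ [exit_colour f x D]) ! 0 = x"
  by (induction D arbitrary: x) auto

lemma under_colours_nth:
  assumes "exit_colour f x (E @ F) = y"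
  shows "(under_colours f x (E @ F) @ [y]) ! num_crossings E = exit_colour f x E"
  using hd_under_colours[of f "exit_colour f x E" F] assms
  by (cases "num_crossings F = 0")
    (simp_all add: under_colours_append nth_append length_under_colours)

text \<open>The appended \<open>[x]\<close> supplies the single arc of the diagram without
  crossings.\<close>

definition to_arcs :: "gauss_code \<Rightarrow> 'a \<times> (nat \<Rightarrow> 'a) \<Rightarrow> nat \<Rightarrow> 'a" where
  "to_arcs D = (\<lambda>(x, f). \<lambda>r\<in>{..<num_arcs D}. (under_colours f x D @ [x]) ! r)"

text \<open>The base point lies on arc 0, whence the base colour \<open>X 0\<close>.\<close>

definition to_edges :: "gauss_code \<Rightarrow> (nat \<Rightarrow> 'a) \<Rightarrow> 'a \<times> (nat \<Rightarrow> 'a)" where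
  "to_edges D X = (X 0, \<lambda>a\<in>label ` set D. X (arc_of_label D a))"

lemma mod_num_crossings_less: "k mod num_crossings D < num_arcs D" if "gauss_code D" "D \<noteq> [] \<or> k = 0"
  using that num_crossings_pos[of D] by (auto simp: num_arcs_def less_max_iff_disj)

lemma to_arcs_prefix:
  assumes D: "gauss_code (E @ F)" and xf: "(x, f) \<in> edge_colourings (E @ F)"
  shows "to_arcs (E @ F) (x, f) (num_crossings E mod num_crossings (E @ F)) = exit_colour f x E"
proof -
  let ?D = "E @ F"
  have ex: "exit_colour f x ?D = x"
    using xf by (simp add: edge_colourings_def)
  have less: "num_crossings E mod num_crossings ?D < num_arcs ?D"
    using D by (intro mod_num_crossings_less) auto
  show ?thesis
  \<comment> \<open>If all lower passages lie in \<open>E\<close>, the index wraps round to 0. The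
    remaining \<open>F\<close> then has upper passages only, so the colour after \<open>E\<close> is
    already the closing colour \<open>x\<close>.\<close>
  proof (cases "num_crossings F = 0 \<and> num_crossings E > 0")
    case False
    then have "num_crossings E mod num_crossings ?D = num_crossings E" by auto
    then show ?thesis
      using less under_colours_nth[OF ex] by (simp add: to_arcs_def)
  next
    case True
    have "exit_colour f y F = y" for y
    proof -
      have "\<forall>p\<in>set F. over p"
        using True by (auto simp: num_crossings_def underpasses_def filter_empty_conv)
      then show ?thesis by (induction F arbitrary: y) auto
    qed
    then have "exit_colour f x E = x" using ex by simp
    moreover have "(under_colours f x ?D @ [x]) ! 0 = x"
      using hd_under_colours[of f x ?D] ex by simp
    ultimately show ?thesis
      using less True by (simp add: to_arcs_def)
  qed
qed

lemma to_arcs_arc_of_label: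
  assumes D: "gauss_code D" and xf: "(x, f) \<in> edge_colourings D" and a: "a \<in> label ` set D"
  shows "to_arcs D (x, f) (arc_of_label D a) = f a"
proof -
  obtain E p F where split: "D = E @ p # F" "over p" "label p = a"
    using overpass_splitE[OF D a] .
  have "consistent f x (E @ p # F)"
    using xf split by (simp add: edge_colourings_def)
  then have "f a = exit_colour f x E"
    using split by simp
  then show ?thesis
    using to_arcs_prefix[of E "p # F"] arc_of_label_append[of E p F] D xf split by auto
qed

text \<open>Splitting the code at the \<open>r\<close>-th lower passage \<open>p\<close> turns the
  relation at crossing \<open>r\<close> into one step of \<open>exit_colour\<close>, from
  \<open>E\<close> to \<open>E @ [p]\<close>.\<close>

lemma to_arcs_mem:
  assumes D: "gauss_code D" and xf: "(x, f) \<in> edge_colourings D"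
  shows "to_arcs D (x, f) \<in> arc_colourings D"
proof -
  have x: "x \<in> S" and f: "f \<in> label ` set D \<rightarrow>\<^sub>E S"
    using xf by (auto simp: edge_colourings_def)
  have cl: "exit_colour f x E \<in> S" if "set E \<subseteq> set D" for E
    using that x f by (intro exit_colour_closed) auto
  have "to_arcs D (x, f) r \<in> S" if r: "r < num_arcs D" for r
  proof (cases "r < num_crossings D")
    case True
    then obtain E p F where split: "D = E @ p # F" "num_crossings E = r"
      by (rule underpass_splitE)
    then have "to_arcs D (x, f) r = exit_colour f x E"
      using to_arcs_prefix[of E "p # F" x f] D xf True by auto
    then show ?thesis
      using cl[of E] split by auto
  next
    case False
    then show ?thesis
      using r num_crossings_pos[OF D] x by (cases "D = []") (auto simp: to_arcs_def num_arcs_def)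
  qed
  moreover have "to_arcs D (x, f) (out_arc D r) =
      op (crossing_positive D r) (to_arcs D (x, f) (in_arc D r)) (to_arcs D (x, f) (over_arc D r))"
    if r: "r < num_crossings D" for r
  proof -
    obtain E p F where split: "D = E @ p # F" "\<not> over p" "num_crossings E = r"
      using underpass_splitE[OF r] .
    have p: "underpasses D ! r = p" "label p \<in> label ` set D"
      using split underpasses_nth_append[of p E F] by auto
    have "to_arcs D (x, f) (in_arc D r) = exit_colour f x E"
      using to_arcs_prefix[of E "p # F" x f] D xf r split by (simp add: in_arc_def)
    moreover have "to_arcs D (x, f) (out_arc D r) = exit_colour f x (E @ [p])"
      using to_arcs_prefix[of "E @ [p]" F x f] D xf r split by (simp add: out_arc_def)
    moreover have "to_arcs D (x, f) (over_arc D r) = f (label p)"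
      using to_arcs_arc_of_label[OF D xf p(2)] by (simp add: over_arc_eq_arc_of_label p)
    ultimately show ?thesis
      unfolding crossing_positive_def p(1) using split by simp
  qed
  ultimately show ?thesis
    by (auto simp: arc_colourings_def to_arcs_def)
qed

text \<open>The prefix grows at its end while the whole code, and with it the numbering of the arcs,
  stays fixed. An upper passage stays on the arc whose colour \<open>to_edges\<close> records; a
  lower one leads to the next arc by the crossing relation.\<close>

lemma to_edges_prefix:
  assumes "gauss_code (E @ F)" "X \<in> arc_colourings (E @ F)" "to_edges (E @ F) X = (x, f)"
  shows "exit_colour f x E = X (num_crossings E mod num_crossings (E @ F)) \<and> consistent f x E"
  using assms
proof (induction E arbitrary: F rule: rev_induct)
  case Nil
  then show ?case by (simp add: to_edges_def)
next
  case (snoc p E)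
  let ?D = "E @ p # F"
  have D: "gauss_code ?D" and X: "X \<in> arc_colourings ?D" and xf: "to_edges ?D X = (x, f)"
    using snoc.prems by simp_all
  have IH: "exit_colour f x E = X (num_crossings E mod num_crossings ?D)" "consistent f x E"
    using snoc.IH[OF D X xf] by auto
  have f: "f (label p) = X (arc_of_label ?D (label p))"
    using xf by (auto simp: to_edges_def)
  show ?case
  proof (cases "over p")
    case True
    then show ?thesis
      using IH f arc_of_label_append[OF D] by simp
  next
    case False
    let ?r = "num_crossings E"
    have r: "?r < num_crossings ?D" using False by simp
    have p: "underpasses ?D ! ?r = p"
      using False by (rule underpasses_nth_append)
    have "X (out_arc ?D ?r) = op (crossing_positive ?D ?r) (X (in_arc ?D ?r)) (X (over_arc ?D ?r))"
      using X r unfolding arc_colourings_def by blast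
    then have "X (Suc ?r mod num_crossings ?D) = op (positive p) (X ?r) (f (label p))"
      unfolding out_arc_def crossing_positive_def in_arc_def over_arc_eq_arc_of_label p f .
    then show ?thesis
      using IH False by simp
  qed
qed

lemma to_edges_mem:
  assumes D: "gauss_code D" and X: "X \<in> arc_colourings D"
  shows "to_edges D X \<in> edge_colourings D"
proof -
  obtain x f where xf: "to_edges D X = (x, f)" by force
  have "exit_colour f x D = x" "consistent f x D"
    using to_edges_prefix[of D "[]" X x f] D X xf by (auto simp: to_edges_def)
  moreover have "x \<in> S"
    using xf X by (auto simp: to_edges_def arc_colourings_def PiE_iff num_arcs_def)
  moreover have "f \<in> label ` set D \<rightarrow>\<^sub>E S"
    using xf X mod_num_crossings_less[OF D]
    by (fastforce simp: to_edges_def arc_colourings_def PiE_iff arc_of_label_def)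
  ultimately show ?thesis
    by (simp add: xf edge_colourings_def)
qed

lemma card_arc_colourings:
  assumes D: "gauss_code D"
  shows "card (arc_colourings D) = card (edge_colourings D)"
proof (rule bij_betw_same_card)
  have "to_arcs D (to_edges D X) = X" if X: "X \<in> arc_colourings D" for X
  proof
    fix r
    obtain x f where xf: "to_edges D X = (x, f)" by force
    have "r \<ge> num_arcs D \<or> r < num_crossings D \<or> D = [] \<and> r = 0"
      using num_crossings_pos[OF D] by (cases "D = []") (auto simp: num_arcs_def not_less)
    then consider "r \<ge> num_arcs D" | "r < num_crossings D" | "D = []" "r = 0" by blast
    then show "to_arcs D (to_edges D X) r = X r"
    proof cases
      case 1
      then show ?thesis
        using X by (auto simp: to_arcs_def arc_colourings_def PiE_iff extensional_def split: prod.split)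
    next
      case 2
      then obtain E p F where split: "D = E @ p # F" "num_crossings E = r"
        by (rule underpass_splitE)
      then show ?thesis
        using to_arcs_prefix[of E "p # F" x f] to_edges_prefix[of E "p # F" X x f]
          to_edges_mem[OF D X] D X xf 2 by auto
    next
      case 3
      then show ?thesis by (simp add: to_arcs_def to_edges_def num_arcs_def)
    qed
  qed
  moreover have "to_edges D (to_arcs D (x, f)) = (x, f)" if xf: "(x, f) \<in> edge_colourings D" for x f
  proof -
    have "(\<lambda>a\<in>label ` set D. to_arcs D (x, f) (arc_of_label D a)) = f"
      using to_arcs_arc_of_label[OF D xf] xf
      by (auto simp: edge_colourings_def PiE_iff extensional_def fun_eq_iff)
    then show ?thesis
      using to_arcs_prefix[of "[]" D x f] D xf by (simp add: to_edges_def)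
  qed
  ultimately show "bij_betw (to_edges D) (arc_colourings D) (edge_colourings D)"
    using to_arcs_mem[OF D] to_edges_mem[OF D]
    by (intro bij_betw_byWitness[where f' = "to_arcs D"]) auto
qed

section \<open>The number of colourings as a knot invariant\<close>

lemma card_arc_colourings_move:
  assumes "move D E" "gauss_code D" "gauss_code E"
  shows "card (arc_colourings D) = card (arc_colourings E)"
  using assms by (simp add: card_arc_colourings card_edge_colourings_move)

lemma card_arc_colourings_knot:
  assumes K: "K \<in> knots" and D: "D \<in> K" and E: "E \<in> K"
  shows "card (arc_colourings D) = card (arc_colourings E)"
proof -
  let ?R = "\<lambda>D E. knot_diagram D \<and> knot_diagram E \<and> move D E"
  obtain D0 where D0: "K = same_knot `` {D0}"
    using K by (auto simp: knots_def quotient_def)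
  have eq: "card (arc_colourings D0) = card (arc_colourings F)" if "equivclp ?R D0 F" for F
    using that
  proof (induction rule: equivclp_induct)
    case (step y z)
    then show ?case
      using card_arc_colourings_move[of y z] card_arc_colourings_move[of z y]
      by (auto simp: knot_diagram_def)
  qed simp
  moreover have "equivclp ?R D0 D" "equivclp ?R D0 E"
    using D E by (simp_all add: D0 same_knot_def)
  ultimately show ?thesis
    by metis
qed

end

section \<open>Linear congruences\<close>

text \<open>The counting form of back substitution: the other unknowns are fixed first, and the
  admissible values of unknown \<open>i\<close> are counted for each choice.\<close>

lemma card_PiE_insert_filter:
  assumes "finite I" "finite S" "i \<notin> I"
  shows "card {X \<in> insert i I \<rightarrow>\<^sub>E S. P X} = (\<Sum>Y \<in> I \<rightarrow>\<^sub>E S. card {x \<in> S. P (Y(i := x))})"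
proof -
  have "bij_betw (\<lambda>(Y, x). Y(i := x)) (SIGMA Y:I \<rightarrow>\<^sub>E S. {x \<in> S. P (Y(i := x))})
      {X \<in> insert i I \<rightarrow>\<^sub>E S. P X}"
    using assms(3)
    by (intro bij_betw_byWitness[where f' = "\<lambda>X. (restrict X I, X i)"])
      (auto simp: PiE_iff extensional_def fun_upd_idem)
  from bij_betw_same_card[OF this] show ?thesis
    using assms by (simp add: card_SigmaI finite_PiE)
qed

lemma card_residue_class:
  fixes n h w :: int
  assumes "n > 0" "h > 0" "h dvd n"
  shows "card {x \<in> {0..<n}. h dvd x - w} = nat (n div h)"
proof -
  obtain q where q: "n = h * q" using assms by auto
  have q_pos: "q > 0" using assms q by (simp add: zero_less_mult_iff)
  \<comment> \<open>The class consists of the smallest nonnegative representative plus multiples of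
    \<open>h\<close>; division by \<open>h\<close> recovers the multiplier.\<close>
  have "bij_betw (\<lambda>k. w mod h + h * k) {0..<q} {x \<in> {0..<n}. h dvd x - w}"
  proof (rule bij_betw_byWitness[where f' = "\<lambda>x. x div h"])
    show "\<forall>k\<in>{0..<q}. (w mod h + h * k) div h = k"
      using assms by simp
    show "\<forall>x\<in>{x \<in> {0..<n}. h dvd x - w}. w mod h + h * (x div h) = x"
    proof
      fix x assume "x \<in> {x \<in> {0..<n}. h dvd x - w}"
      then have "x mod h = w mod h" by (simp add: mod_eq_dvd_iff)
      then show "w mod h + h * (x div h) = x" by (metis mod_mult_div_eq)
    qed
    have "w mod h + h * k < n" if "k < q" for k
    proof -
      have "w mod h + h * k < h * (k + 1)" using assms by (simp add: ring_distribs)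
      also have "\<dots> \<le> n" using assms that unfolding q by (intro mult_left_mono) auto
      finally show ?thesis .
    qed
    moreover have "h dvd w mod h + h * k - w" for k
      by (simp add: mod_eq_dvd_iff[symmetric])
    ultimately show "(\<lambda>k. w mod h + h * k) ` {0..<q} \<subseteq> {x \<in> {0..<n}. h dvd x - w}"
      using assms by auto
    show "(\<lambda>x. x div h) ` {x \<in> {0..<n}. h dvd x - w} \<subseteq> {0..<q}"
    proof clarsimp
      fix x assume x: "0 \<le> x" "x < n"
      have "h * (x div h) \<le> x"
        using assms(2) by (metis mult.commute div_mult_mod_eq le_add_same_cancel1 pos_mod_sign)
      also have "x < h * q" using x q by simp
      finally show "0 \<le> x div h \<and> x div h < q"
        using x assms(2) by (simp add: pos_imp_zdiv_nonneg_iff)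
    qed
  qed
  from bij_betw_same_card[OF this] show ?thesis
    using assms q by simp
qed

lemma div_dvd_pos:
  fixes n g :: int
  assumes "n > 0" "g > 0" "g dvd n"
  shows "n div g > 0" "n div g dvd n" "n div (n div g) = g"
proof -
  obtain k where k: "n = g * k" using assms by auto
  then have "k > 0" using assms by (simp add: zero_less_mult_iff)
  then show "n div g > 0" "n div g dvd n" "n div (n div g) = g"
    using assms(2) by (simp_all add: k)
qed

text \<open>Once \<open>gcd a n\<close> is divided out, what remains of \<open>a\<close> is coprime
  to what remains of \<open>n\<close> and can be cancelled.\<close>

lemma dvd_mult_iff_div_gcd_dvd:
  fixes a n z :: int
  assumes "n > 0"
  shows "n dvd a * z \<longleftrightarrow> n div gcd a n dvd z"
proof -
  define g where "g = gcd a n"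
  have g: "g > 0" "gcd a n \<noteq> 0" using assms by (auto simp: g_def)
  obtain a' n' where an: "a = a' * g" "n = n' * g" "coprime a' n'"
    using gcd_coprime_exists[OF g(2)] unfolding g_def by blast
  have az: "a * z = a' * z * g"
    by (simp add: an(1) ac_simps)
  have "n dvd a * z \<longleftrightarrow> n' dvd a' * z"
    unfolding az an(2) using g(1) by simp
  also have "\<dots> \<longleftrightarrow> n' dvd z"
    using an(3) by (simp add: coprime_dvd_mult_right_iff coprime_commute)
  also have "n' = n div g"
    using g(1) by (simp add: an(2))
  finally show ?thesis
    by (simp add: g_def)
qed

text \<open>A particular solution \<open>w\<close>, if there is one, reduces the congruence to a
  single residue class modulo \<open>n div gcd a n\<close>. Otherwise \<open>gcd a n\<close> divides
  \<open>a * x\<close> and \<open>n\<close> but not \<open>b\<close>.\<close>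

lemma card_linear_congruence:
  fixes n a b :: int
  assumes n: "n > 0"
  shows "card {x \<in> {0..<n}. n dvd a * x + b} = (if gcd a n dvd b then nat (gcd a n) else 0)"
proof (cases "gcd a n dvd b")
  case True
  then obtain w where w: "[a * w = - b] (mod n)"
    using cong_solve_dvd_int[of a n "- b"] by auto
  have "n dvd a * x + b \<longleftrightarrow> n div gcd a n dvd x - w" for x
  proof -
    have "n dvd a * w + b" using w by (simp add: cong_iff_dvd_diff)
    then have "n dvd a * x + b \<longleftrightarrow> n dvd (a * x + b) - (a * w + b)"
      by (metis dvd_diff_right_iff dvd_diff_left_iff)
    then show ?thesis
      using dvd_mult_iff_div_gcd_dvd[OF n, of a "x - w"] by (simp add: right_diff_distrib)
  qed
  then show ?thesis
    using True n card_residue_class[OF n, of "n div gcd a n" w] div_dvd_pos[OF n, of "gcd a n"] by simp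
next
  case False
  then have "\<not> n dvd a * x + b" for x
    by (metis dvd_add_right_iff dvd_mult2 dvd_trans gcd_dvd1 gcd_dvd2)
  then show ?thesis
    using False by simp
qed

text \<open>For \<open>z = x - w\<close> the first condition says \<open>z = h * k\<close>, and the
  second then says that \<open>d\<close> divides \<open>k\<close>. Together they describe one
  residue class modulo \<open>h * d\<close>, with \<open>gcd a n div d\<close> elements. Multiplying
  by \<open>g\<close> avoids a quotient in the statement, as
  \<open>g = d * gcd (b * h) g\<close>.\<close>

lemma card_two_linear_congruences:
  fixes n a b g w :: int
  assumes n: "n > 0" and g: "g > 0" "g dvd n"
  shows "g * int (card {x \<in> {0..<n}. n dvd a * (x - w) \<and> g dvd b * (x - w)}) =
    gcd a n * gcd (b * (n div gcd a n)) g"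
proof -
  define h where "h = n div gcd a n"
  define d where "d = g div gcd (b * h) g"
  have h: "h > 0" "n = h * gcd a n"
    using n div_dvd_pos(1)[OF n, of "gcd a n"] by (simp_all add: h_def)
  have d: "d > 0" "g = d * gcd (b * h) g"
    using g div_dvd_pos(1)[OF g(1), of "gcd (b * h) g"] by (simp_all add: d_def)
  have iff: "n dvd a * z \<and> g dvd b * z \<longleftrightarrow> h * d dvd z" for z
  proof
    assume *: "n dvd a * z \<and> g dvd b * z"
    then obtain k where k: "z = h * k"
      using dvd_mult_iff_div_gcd_dvd[OF n, of a z] by (auto simp: h_def)
    then show "h * d dvd z"
      using * dvd_mult_iff_div_gcd_dvd[OF g(1), of "b * h" k] by (simp add: d_def mult.assoc)
  next
    assume "h * d dvd z"
    then obtain k where k: "z = h * (d * k)" by (metis dvdE mult.assoc)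
    have "n dvd a * z"
      using dvd_mult_iff_div_gcd_dvd[OF n, of a z] by (simp add: k h_def)
    moreover have "g dvd b * z"
      using dvd_mult_iff_div_gcd_dvd[OF g(1), of "b * h" "d * k"] by (simp add: k d_def mult.assoc)
    ultimately show "n dvd a * z \<and> g dvd b * z" ..
  qed
  \<comment> \<open>This is where \<open>g dvd n\<close> enters, as \<open>n = h * gcd a n\<close>.
    It yields that \<open>h * d\<close> divides \<open>n\<close>, so the residue class modulo
    \<open>h * d\<close> can be counted in \<open>{0..<n}\<close>.\<close>
  have "g dvd b * h * gcd a n"
    using g(2) h(2) by (metis dvd_mult mult.assoc)
  then have "d dvd gcd a n"
    using dvd_mult_iff_div_gcd_dvd[OF g(1), of "b * h"] by (simp add: d_def)
  then obtain e where e: "gcd a n = d * e" by (rule dvdE)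
  have "0 < d * e"
    using n unfolding e[symmetric] by simp
  then have "e > 0"
    using d(1) by (rule zero_less_mult_pos)
  have n_eq: "n = h * d * e"
    using h(2) e by (simp add: mult.assoc)
  have "card {x \<in> {0..<n}. n dvd a * (x - w) \<and> g dvd b * (x - w)} = nat (n div (h * d))"
    unfolding iff using h d n n_eq by (intro card_residue_class) auto
  also have "n div (h * d) = e"
    using n_eq h(1) d(1) by simp
  finally have "int (card {x \<in> {0..<n}. n dvd a * (x - w) \<and> g dvd b * (x - w)}) = e"
    using \<open>e > 0\<close> by simp
  moreover have "g * e = gcd a n * gcd (b * h) g"
    by (subst d(2)) (simp add: e)
  ultimately show ?thesis
    by (simp add: h_def)
qed

section \<open>Back substitution in triangular systems modulo \<open>n\<close>\<close>

definition triangular_solutions :: "int \<Rightarrow> (nat \<Rightarrow> nat \<Rightarrow> int) \<Rightarrow> nat \<Rightarrow> nat \<Rightarrow> (nat \<Rightarrow> int) set" where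
  "triangular_solutions n a N j = {X \<in> {j..<N} \<rightarrow>\<^sub>E {0..<n}.
     \<forall>r\<in>{j..<N}. n dvd (\<Sum>c = j..<N. a r c * X c)}"

text \<open>Only row \<open>j\<close> involves unknown \<open>j\<close>. For a fixed solution of the
  later rows it is a linear congruence in that unknown, with \<open>gcd (a j j) n\<close> solutions
  or none.\<close>

lemma card_triangular_solutions_step:
  fixes a :: "nat \<Rightarrow> nat \<Rightarrow> int"
  assumes n: "n > 0" and j: "j < N" and tri: "\<And>r. r \<in> {Suc j..<N} \<Longrightarrow> a r j = 0"
  shows "card (triangular_solutions n a N j) =
    nat (gcd (a j j) n) * card {Y \<in> triangular_solutions n a N (Suc j).
      gcd (a j j) n dvd (\<Sum>c = Suc j..<N. a j c * Y c)}"
proof -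
  let ?S = "{0..<n}" and ?I = "{Suc j..<N}"
  let ?L = "\<lambda>Y. \<Sum>c\<in>?I. a j c * Y c"
  let ?P = "\<lambda>X. \<forall>r\<in>{j..<N}. n dvd (\<Sum>c = j..<N. a r c * X c)"
  have I: "{j..<N} = insert j ?I" using j by auto
  have upd: "(\<Sum>c\<in>?I. a r c * (Y(j := x)) c) = (\<Sum>c\<in>?I. a r c * Y c)" for r Y x
    by (intro sum.cong) auto
  have P: "?P (Y(j := x)) \<longleftrightarrow> (\<forall>r\<in>?I. n dvd (\<Sum>c\<in>?I. a r c * Y c)) \<and> n dvd a j j * x + ?L Y" for Y x
    unfolding I by (simp add: upd tri) (rule conj_commute)
  have guard: "card {x \<in> ?S. R \<and> Q x} = (if R then card {x \<in> ?S. Q x} else 0)" for R Q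
    by simp
  have "card (triangular_solutions n a N j) = card {X \<in> insert j ?I \<rightarrow>\<^sub>E ?S. ?P X}"
    by (simp add: triangular_solutions_def flip: I)
  also have "\<dots> = (\<Sum>Y \<in> ?I \<rightarrow>\<^sub>E ?S. card {x \<in> ?S. ?P (Y(j := x))})"
    by (rule card_PiE_insert_filter) auto
  also have "\<dots> = (\<Sum>Y \<in> ?I \<rightarrow>\<^sub>E ?S. if Y \<in> triangular_solutions n a N (Suc j) then
      card {x \<in> ?S. n dvd a j j * x + ?L Y} else 0)"
    unfolding P guard by (intro sum.cong) (simp_all add: triangular_solutions_def)
  also have "\<dots> = (\<Sum>Y \<in> ?I \<rightarrow>\<^sub>E ?S. if Y \<in> triangular_solutions n a N (Suc j) \<and> gcd (a j j) n dvd ?L Y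
      then nat (gcd (a j j) n) else 0)"
    unfolding card_linear_congruence[OF n] by (intro sum.cong) auto
  also have "\<dots> = (\<Sum>Y \<in> {Y \<in> triangular_solutions n a N (Suc j). gcd (a j j) n dvd ?L Y}. nat (gcd (a j j) n))"
    by (intro sum.mono_neutral_cong_right) (auto simp: triangular_solutions_def intro!: finite_PiE)
  finally show ?thesis by simp
qed

lemma card_triangular_solutions_unit:
  assumes "n > 0" "j < N" "\<And>r. r \<in> {Suc j..<N} \<Longrightarrow> a r j = 0" "coprime (a j j) n"
  shows "card (triangular_solutions n a N j) = card (triangular_solutions n a N (Suc j))"
  using card_triangular_solutions_step[of n j N a] assms by simp

lemma card_triangular_solutions_type_II:
  fixes a :: "nat \<Rightarrow> nat \<Rightarrow> int"
  assumes n: "n > 0"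
    and tri: "\<And>r c. c < r \<Longrightarrow> r < k + 3 \<Longrightarrow> a r c = 0"
    and diag: "\<And>j. j < k \<Longrightarrow> a j j = 1"
    and rows: "a k k = \<alpha>1" "a k (k + 1) = \<beta>1" "a k (k + 2) = - (\<alpha>1 + \<beta>1)"
      "a (k + 1) (k + 1) = \<alpha>2" "a (k + 1) (k + 2) = - \<alpha>2" "a (k + 2) (k + 2) = 0"
  shows "int (card (triangular_solutions n a (k + 3) 0)) =
    n * gcd \<alpha>2 n * gcd (\<beta>1 * (n div gcd \<alpha>2 n)) (gcd \<alpha>1 n)"
proof -
  let ?T = "triangular_solutions n a (k + 3)" and ?S = "{0..<n}"
  let ?g = "gcd \<alpha>1 n"
  let ?Q = "\<lambda>Y. n dvd \<alpha>2 * (Y (k + 1) - Y (k + 2)) \<and> ?g dvd \<beta>1 * (Y (k + 1) - Y (k + 2))"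
  have "card (?T 0) = card (?T j)" if "j \<le> k" for j
    using that
  proof (induction j)
    case (Suc j)
    then show ?case
      using card_triangular_solutions_unit[OF n, of j "k + 3" a] tri diag by simp
  qed simp
  then have "card (?T 0) = card (?T k)" by simp
  also have "\<dots> = nat ?g * card {Y \<in> ?T (Suc k). ?g dvd (\<Sum>c = Suc k..<k + 3. a k c * Y c)}"
    using card_triangular_solutions_step[OF n, of k "k + 3" a] tri rows by simp
  also have "{Y \<in> ?T (Suc k). ?g dvd (\<Sum>c = Suc k..<k + 3. a k c * Y c)} =
      {Y \<in> insert (k + 1) {k + 2} \<rightarrow>\<^sub>E ?S. ?Q Y}"
  proof -
    have I: "{Suc k..<k + 3} = {k + 1, k + 2}" by auto
    \<comment> \<open>The two expressions differ by \<open>\<alpha>1 * z\<close>, a multiple of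
      \<open>gcd \<alpha>1 n\<close>.\<close>
    have "?g dvd \<beta>1 * y + - (\<alpha>1 + \<beta>1) * z \<longleftrightarrow> ?g dvd \<beta>1 * (y - z)" for y z
    proof -
      have "\<beta>1 * (y - z) = (\<beta>1 * y + - (\<alpha>1 + \<beta>1) * z) + \<alpha>1 * z" by (simp add: algebra_simps)
      then show ?thesis
        by (metis dvd_add_left_iff dvd_mult2 gcd_dvd1)
    qed
    moreover have "a (k + 2) (k + 1) = 0" using tri by simp
    ultimately show ?thesis
      unfolding triangular_solutions_def I using rows by (auto simp: right_diff_distrib)
  qed
  also have "card \<dots> = (\<Sum>Y \<in> {k + 2} \<rightarrow>\<^sub>E ?S. card {x \<in> ?S. ?Q (Y(k + 1 := x))})"
    by (rule card_PiE_insert_filter) auto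
  finally have "int (card (?T 0)) = (\<Sum>Y \<in> {k + 2} \<rightarrow>\<^sub>E ?S. ?g * int (card {x \<in> ?S. ?Q (Y(k + 1 := x))}))"
    by (simp add: sum_distrib_left)
  \<comment> \<open>The count does not depend on the value of the last unknown, which is free; its
    \<open>n\<close> values give the factor \<open>n\<close>.\<close>
  also have "\<dots> = (\<Sum>Y \<in> {k + 2} \<rightarrow>\<^sub>E ?S. gcd \<alpha>2 n * gcd (\<beta>1 * (n div gcd \<alpha>2 n)) ?g)"
    using n card_two_linear_congruences[where n = n and g = ?g and a = \<alpha>2 and b = \<beta>1]
    by (intro sum.cong refl) simp
  finally show ?thesis
    using n by (simp add: card_PiE)
qed

section \<open>Colouring matrices\<close>

text \<open>\<open>evaluate\<close> without the final reduction, so that it is additive exactly and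
  not just modulo \<open>n\<close>.\<close>

definition laurent_eval :: "int \<Rightarrow> int \<Rightarrow> laurent \<Rightarrow> int" where
  "laurent_eval n m p = (\<Sum>k \<in> Poly_Mapping.keys p. Poly_Mapping.lookup p k * power_mod n m k)"

lemma evaluate_cong_laurent_eval: "[evaluate n m p = laurent_eval n m p] (mod n)"
  by (simp add: evaluate_def laurent_eval_def cong_def)

lemma laurent_eval_superset:
  assumes "finite I" "Poly_Mapping.keys p \<subseteq> I"
  shows "laurent_eval n m p = (\<Sum>k \<in> I. Poly_Mapping.lookup p k * power_mod n m k)"
  unfolding laurent_eval_def using assms
  by (intro sum.mono_neutral_left) (auto simp: in_keys_iff)

lemma laurent_eval_add: "laurent_eval n m (p + q) = laurent_eval n m p + laurent_eval n m q"
  using Poly_Mapping.keys_add[of p q]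
  by (simp add: laurent_eval_superset[of "Poly_Mapping.keys p \<union> Poly_Mapping.keys q"]
      lookup_add sum.distrib algebra_simps)

lemma laurent_eval_zero [simp]: "laurent_eval n m 0 = 0"
  by (simp add: laurent_eval_def)

lemma laurent_eval_single: "laurent_eval n m (Poly_Mapping.single k c) = c * power_mod n m k"
  by (simp add: laurent_eval_def)

lemma laurent_eval_uminus: "laurent_eval n m (- p) = - laurent_eval n m p"
  using laurent_eval_add[of n m p "- p"] by simp

text \<open>By additivity it is enough to compare monomials. The result is a congruence because the
  modular inverse inverts \<open>m\<close> only modulo \<open>n\<close>.\<close>

lemma laurent_eval_single_mult:
  assumes "\<And>k. [power_mod n m (j + k) = u * power_mod n m k] (mod n)"
  shows "[laurent_eval n m (Poly_Mapping.single j 1 * p) = u * laurent_eval n m p] (mod n)"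
proof (induction p rule: update_induct)
  case const
  then show ?case by simp
next
  case (update p k c)
  have split: "Poly_Mapping.update k c p = p + Poly_Mapping.single k c"
    using update(1) by (intro poly_mapping_eqI) (auto simp: lookup_update lookup_add lookup_single when_def in_keys_iff)
  have "[c * power_mod n m (j + k) = u * (c * power_mod n m k)] (mod n)"
    using cong_scalar_left[OF assms[of k], of c] by (simp add: ac_simps)
  with update show ?case
    by (simp add: split laurent_eval_add laurent_eval_single mult_single ring_distribs cong_add)
qed

section \<open>Evaluation at a unit modulo \<open>n\<close>\<close>

locale alexander =
  fixes n m :: int
  assumes n_pos: "n > 0" and coprime: "coprime m n"
begin

abbreviation weight :: "bool \<Rightarrow> int" where
  "weight s \<equiv> if s then m else modular_inverse n m"

lemma inverse_cong: "[m * modular_inverse n m = 1] (mod n)" "[modular_inverse n m * m = 1] (mod n)"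
  using cong_modular_inverse1 cong_modular_inverse2 coprime by blast+

lemma power_mod_Suc: "[power_mod n m (1 + k) = m * power_mod n m k] (mod n)"
proof (cases "k \<ge> 0")
  case True
  then show ?thesis by (simp add: power_mod_def nat_add_distrib)
next
  case False
  \<comment> \<open>For negative \<open>k\<close>, one of the \<open>l + 1\<close> factors of the
    inverse cancels against \<open>m\<close>. At \<open>l = 0\<close> the exponent
    \<open>1 + k\<close> is 0 and falls under the nonnegative branch of
    \<open>power_mod\<close>.\<close>
  define l where "l = nat (- k - 1)"
  have k: "k = - int l - 1" using False by (simp add: l_def)
  have "[modular_inverse n m ^ l * 1 = modular_inverse n m ^ l * (m * modular_inverse n m)] (mod n)"
    by (intro cong_scalar_left) (simp add: inverse_cong cong_sym)
  then show ?thesis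
    by (cases "l = 0") (auto simp: power_mod_def k nat_add_distrib nat_diff_distrib ac_simps)
qed

lemma power_mod_pred: "[power_mod n m (- 1 + k) = modular_inverse n m * power_mod n m k] (mod n)"
proof -
  have "[modular_inverse n m * power_mod n m (1 + (- 1 + k)) =
      modular_inverse n m * (m * power_mod n m (- 1 + k))] (mod n)"
    by (intro cong_scalar_left power_mod_Suc)
  moreover have "[(modular_inverse n m * m) * power_mod n m (- 1 + k) = 1 * power_mod n m (- 1 + k)] (mod n)"
    by (intro cong_scalar_right inverse_cong)
  ultimately show ?thesis
    by (simp add: mult.assoc) (metis cong_sym cong_trans)
qed

lemma laurent_eval_unit_mult:
  "[laurent_eval n m (indet * p) = m * laurent_eval n m p] (mod n)"
  "[laurent_eval n m (indet_inv * p) = modular_inverse n m * laurent_eval n m p] (mod n)"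
  unfolding indet_def indet_inv_def
  by (intro laurent_eval_single_mult power_mod_Suc power_mod_pred)+

section \<open>Solutions modulo \<open>n\<close> under the matrix operations\<close>

definition solutions :: "laurent mat \<Rightarrow> (nat \<Rightarrow> int) set" where
  "solutions A = {X \<in> {..<dim_col A} \<rightarrow>\<^sub>E {0..<n}. \<forall>r < dim_row A.
     n dvd (\<Sum>c < dim_col A. laurent_eval n m (A $$ (r, c)) * X c)}"

text \<open>Each admissible factor evaluates to a unit \<open>u\<close> modulo \<open>n\<close>, and
  a unit does not affect divisibility by \<open>n\<close>.\<close>

lemma unit_dvd_iff:
  assumes x: "x \<in> {indet, indet_inv, - 1}"
  shows "n dvd (\<Sum>c\<in>I. laurent_eval n m (x * p c) * X c) \<longleftrightarrow>
    n dvd (\<Sum>c\<in>I. laurent_eval n m (p c) * X c)"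
proof -
  obtain u where u: "coprime u n" "\<And>p. [laurent_eval n m (x * p) = u * laurent_eval n m p] (mod n)"
  proof -
    have "coprime m n" "coprime (modular_inverse n m) n" "coprime (- 1) n"
      using coprime coprime_modular_inverse by auto
    then show thesis
      using x that laurent_eval_unit_mult
      by (elim insertE emptyE) (auto simp: laurent_eval_uminus intro: that[of "-1"])
  qed
  have "[(\<Sum>c\<in>I. laurent_eval n m (x * p c) * X c) =
      (\<Sum>c\<in>I. u * laurent_eval n m (p c) * X c)] (mod n)"
    by (intro cong_sum cong_scalar_right u)
  then have "n dvd (\<Sum>c\<in>I. laurent_eval n m (x * p c) * X c) \<longleftrightarrow>
      n dvd u * (\<Sum>c\<in>I. laurent_eval n m (p c) * X c)"
    by (simp add: cong_dvd_iff sum_distrib_left mult.assoc)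
  then show ?thesis
    using u(1) by (simp add: coprime_dvd_mult_right_iff coprime_commute)
qed

lemma solutions_multrow:
  assumes "k < dim_row A" "x \<in> {indet, indet_inv, - 1}"
  shows "solutions (multrow k x A) = solutions A"
proof -
  have "n dvd (\<Sum>c<dim_col A. laurent_eval n m (multrow k x A $$ (r, c)) * X c) \<longleftrightarrow>
      n dvd (\<Sum>c<dim_col A. laurent_eval n m (A $$ (r, c)) * X c)" if "r < dim_row A" for r X
    using that unit_dvd_iff[OF assms(2), of "\<lambda>c. A $$ (r, c)" X "{..<dim_col A}"]
    by (cases "r = k") simp_all
  then show ?thesis
    by (simp add: solutions_def)
qed

text \<open>As \<open>k \<noteq> l\<close>, row \<open>l\<close> survives unchanged and can be
  subtracted again.\<close>

lemma solutions_addrow: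
  assumes "k < dim_row A" "l < dim_row A" "k \<noteq> l"
  shows "solutions (addrow 1 k l A) = solutions A"
proof -
  let ?R = "\<lambda>A X r. \<Sum>c<dim_col A. laurent_eval n m (A $$ (r, c)) * X c"
  have R: "?R (addrow 1 k l A) X r = (if r = k then ?R A X l + ?R A X k else ?R A X r)"
    if "r < dim_row A" for r X
    using that by (auto simp: laurent_eval_add ring_distribs sum.distrib)
  have "(\<forall>r<dim_row A. n dvd ?R (addrow 1 k l A) X r) \<longleftrightarrow> (\<forall>r<dim_row A. n dvd ?R A X r)" for X
  proof safe
    fix r assume *: "\<forall>r<dim_row A. n dvd ?R (addrow 1 k l A) X r" and r: "r < dim_row A"
    have "n dvd ?R A X l"
      using * assms R[OF assms(2), of X] by auto
    moreover have "n dvd (if r = k then ?R A X l + ?R A X k else ?R A X r)"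
      using * r unfolding R[OF r, of X, symmetric] by blast
    ultimately show "n dvd ?R A X r"
      by (auto simp: dvd_add_right_iff split: if_splits)
  next
    fix r assume *: "\<forall>r<dim_row A. n dvd ?R A X r" and r: "r < dim_row A"
    then show "n dvd ?R (addrow 1 k l A) X r"
      using assms unfolding R[OF r] by auto
  qed
  then show ?thesis
    by (simp add: solutions_def)
qed

lemma solutions_swaprows:
  assumes "k < dim_row A" "l < dim_row A"
  shows "solutions (swaprows k l A) = solutions A"
proof -
  let ?R = "\<lambda>A X r. \<Sum>c<dim_col A. laurent_eval n m (A $$ (r, c)) * X c"
  have R: "?R (swaprows k l A) X r = ?R A X (transpose k l r)" if "r < dim_row A" for r X
    using that by (auto simp: transpose_def)
  have "(\<forall>r<dim_row A. n dvd ?R (swaprows k l A) X r) \<longleftrightarrow> (\<forall>r<dim_row A. n dvd ?R A X r)" for X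
  proof safe
    fix r assume *: "\<forall>r<dim_row A. n dvd ?R (swaprows k l A) X r" and r: "r < dim_row A"
    have r': "transpose k l r < dim_row A" using assms r by (auto simp: transpose_def)
    then have "n dvd ?R (swaprows k l A) X (transpose k l r)" using * by blast
    then show "n dvd ?R A X r"
      unfolding R[OF r'] by simp
  next
    fix r assume *: "\<forall>r<dim_row A. n dvd ?R A X r" and r: "r < dim_row A"
    have r': "transpose k l r < dim_row A" using assms r by (auto simp: transpose_def)
    then show "n dvd ?R (swaprows k l A) X r"
      using * unfolding R[OF r] by blast
  qed
  then show ?thesis
    by (simp add: solutions_def)
qed

text \<open>Unlike the row operations, this one permutes the unknowns, so the solution set may
  change and only its size is preserved.\<close>

lemma card_solutions_swapcols:
  assumes "k < dim_col A" "l < dim_col A"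
  shows "card (solutions (swapcols k l A)) = card (solutions A)"
proof (rule bij_betw_same_card)
  define \<tau> where "\<tau> = transpose k l"
  have \<tau>: "\<tau> c < dim_col A \<longleftrightarrow> c < dim_col A" "\<tau> (\<tau> c) = c" for c
    using assms by (auto simp: \<tau>_def transpose_def)
  have perm: "bij_betw \<tau> {..<dim_col A} {..<dim_col A}"
    by (rule bij_betw_byWitness[where f' = \<tau>]) (auto simp: \<tau>)
  have swap: "swapcols k l A $$ (r, c) = A $$ (r, \<tau> c)" if "r < dim_row A" "c < dim_col A" for r c
    using that by (auto simp: \<tau>_def transpose_def)
  have "(\<Sum>c<dim_col A. laurent_eval n m (A $$ (r, \<tau> c)) * X c) =
      (\<Sum>c<dim_col A. laurent_eval n m (A $$ (r, c)) * X (\<tau> c))" for r X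
    using sum.reindex_bij_betw[OF perm, of "\<lambda>c. laurent_eval n m (A $$ (r, c)) * X (\<tau> c)"]
    by (simp add: \<tau>)
  then have mem: "X \<in> solutions (swapcols k l A) \<longleftrightarrow> X \<in> {..<dim_col A} \<rightarrow>\<^sub>E {0..<n} \<and>
      (\<forall>r<dim_row A. n dvd (\<Sum>c<dim_col A. laurent_eval n m (A $$ (r, c)) * X (\<tau> c)))" for X
    by (simp add: solutions_def swap del: index_mat_swapcols(1))
  have PiE: "X \<circ> \<tau> \<in> {..<dim_col A} \<rightarrow>\<^sub>E {0..<n}" if "X \<in> {..<dim_col A} \<rightarrow>\<^sub>E {0..<n}" for X :: "nat \<Rightarrow> int"
    using that by (auto simp: PiE_iff extensional_def \<tau>)
  have twice: "X \<circ> \<tau> \<circ> \<tau> = X" for X :: "nat \<Rightarrow> int"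
    by (simp add: fun_eq_iff \<tau>)
  show "bij_betw (\<lambda>X. X \<circ> \<tau>) (solutions (swapcols k l A)) (solutions A)"
    by (rule bij_betw_byWitness[where f' = "\<lambda>X. X \<circ> \<tau>"])
      (simp_all add: image_subset_iff mem solutions_def[of A] PiE \<tau> twice)
qed

lemma card_solutions_equivalent:
  assumes "equivalent_to B A"
  shows "card (solutions B) = card (solutions A)"
  using assms unfolding equivalent_to_def
proof (induction rule: rtranclp_induct)
  case (step B C)
  from step(2) have "card (solutions C) = card (solutions B)"
    by cases (simp_all add: solutions_multrow solutions_addrow solutions_swaprows card_solutions_swapcols)
  with step show ?case by simp
qed simp

section \<open>The Alexander quandle and its colouring matrix\<close>

lemma weight_inverse: "[weight (\<not> s) * weight s = 1] (mod n)"
  using inverse_cong by (cases s) simp_all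

definition alexander_op :: "bool \<Rightarrow> int \<Rightarrow> int \<Rightarrow> int" where
  "alexander_op s x y = (weight s * x + (1 - weight s) * y) mod n"

sublocale finite_quandle "{0..<n}" alexander_op
proof
  show "alexander_op s x y \<in> {0..<n}" for s x y
    using n_pos by (simp add: alexander_op_def)
  show "alexander_op s x x = x" if "x \<in> {0..<n}" for s x
  proof -
    have "weight s * x + (1 - weight s) * x = x" by (simp add: algebra_simps)
    then show ?thesis using that unfolding alexander_op_def by simp
  qed
  show "alexander_op (\<not> s) (alexander_op s x y) y = x" if x: "x \<in> {0..<n}" for s x y
  proof -
    define w w' where "w = weight s" and "w' = weight (\<not> s)"
    have "alexander_op (\<not> s) (alexander_op s x y) y =
        (w' * ((w * x + (1 - w) * y) mod n) + (1 - w') * y) mod n"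
      by (simp only: alexander_op_def w_def w'_def)
    also have "\<dots> = (w' * (w * x + (1 - w) * y) + (1 - w') * y) mod n"
      unfolding cong_def[symmetric] by (intro cong_add cong_scalar_left cong_refl) simp
    \<comment> \<open>Relative to \<open>y\<close>, the operation multiplies the difference
      \<open>x - y\<close> by the weight; the weights of opposite signs are inverse modulo
      \<open>n\<close>.\<close>
    also have "w' * (w * x + (1 - w) * y) + (1 - w') * y = w' * w * (x - y) + y"
      by (simp add: algebra_simps)
    finally have "alexander_op (\<not> s) (alexander_op s x y) y = (w' * w * (x - y) + y) mod n" .
    moreover have "[w' * w * (x - y) + y = 1 * (x - y) + y] (mod n)"
      unfolding w_def w'_def by (intro cong_add cong_scalar_right weight_inverse cong_refl)
    ultimately show ?thesis
      using x by (simp add: cong_def)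
  qed
  show "alexander_op s (alexander_op s' x y) z = alexander_op s' (alexander_op s x z) (alexander_op s y z)"
    for s s' x y z
  proof -
    define w w' where "w = weight s" and "w' = weight s'"
    have "(w * ((w' * x + (1 - w') * y) mod n) + (1 - w) * z) mod n =
        (w * (w' * x + (1 - w') * y) + (1 - w) * z) mod n"
      unfolding cong_def[symmetric] by (intro cong_add cong_scalar_left cong_refl) simp
    \<comment> \<open>An identity already over the integers: the operations are affine combinations
      and the weights commute.\<close>
    also have "w * (w' * x + (1 - w') * y) + (1 - w) * z =
        w' * (w * x + (1 - w) * z) + (1 - w') * (w * y + (1 - w) * z)"
      by (simp add: algebra_simps)
    also have "\<dots> mod n =
        (w' * ((w * x + (1 - w) * z) mod n) + (1 - w') * ((w * y + (1 - w) * z) mod n)) mod n"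
      unfolding cong_def[symmetric] by (intro cong_add cong_scalar_left) simp_all
    finally show ?thesis
      by (simp only: alexander_op_def w_def w'_def)
  qed
qed simp

lemma colourings_eq_arc_colourings: "colourings n m D = arc_colourings D"
proof -
  have "(if s then quandle_op n m x y else quandle_op' n m x y) = alexander_op s x y" for s x y
    by (simp add: quandle_op_def quandle_op'_def alexander_op_def)
  then show ?thesis
    by (simp add: colourings_def arc_colourings_def)
qed

lemma laurent_eval_unit: "laurent_eval n m indet = m" "laurent_eval n m indet_inv = modular_inverse n m"
  "laurent_eval n m 1 = 1"
  by (simp_all add: indet_def indet_inv_def laurent_eval_single power_mod_def flip: single_one)

lemma solutions_colouring_matrix:
  assumes "num_crossings D \<ge> 1"
  shows "solutions (colouring_matrix D) = colourings n m D"
proof -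
  let ?N = "num_crossings D"
  have N: "num_arcs D = ?N" using assms by (simp add: num_arcs_def)
  have "n dvd (\<Sum>c<?N. laurent_eval n m (colouring_matrix D $$ (r, c)) * X c) \<longleftrightarrow>
      X (out_arc D r) = alexander_op (crossing_positive D r) (X (in_arc D r)) (X (over_arc D r))"
    if r: "r < ?N" and X: "X \<in> {..<?N} \<rightarrow>\<^sub>E {0..<n}" for r X
  proof -
    define w where "w = weight (crossing_positive D r)"
    have arcs: "in_arc D r < ?N" "over_arc D r < ?N" "out_arc D r < ?N"
      using r by (simp_all add: in_arc_def over_arc_def out_arc_def)
    have "laurent_eval n m (colouring_matrix D $$ (r, c)) =
        (if c = in_arc D r then w else 0) + (if c = over_arc D r then 1 - w else 0) +
        (if c = out_arc D r then - 1 else 0)" if "c < ?N" for c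
      using r that laurent_eval_add[of n m 1 "- indet"] laurent_eval_add[of n m 1 "- indet_inv"]
      by (auto simp: colouring_matrix_def Let_def w_def laurent_eval_add laurent_eval_uminus laurent_eval_unit)
    then have "(\<Sum>c<?N. laurent_eval n m (colouring_matrix D $$ (r, c)) * X c) =
        (\<Sum>c<?N. (if c = in_arc D r then w * X c else 0) + (if c = over_arc D r then (1 - w) * X c else 0) +
          (if c = out_arc D r then - X c else 0))"
      by (intro sum.cong) (auto simp: ring_distribs)
    also have "\<dots> = w * X (in_arc D r) + (1 - w) * X (over_arc D r) - X (out_arc D r)"
      using arcs by (simp add: sum.distrib)
    finally have "n dvd (\<Sum>c<?N. laurent_eval n m (colouring_matrix D $$ (r, c)) * X c) \<longleftrightarrow>
        (w * X (in_arc D r) + (1 - w) * X (over_arc D r)) mod n = X (out_arc D r) mod n"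
      by (simp add: mod_eq_dvd_iff)
    \<comment> \<open>Colours are reduced representatives, so the congruence is an equality.\<close>
    also have "X (out_arc D r) mod n = X (out_arc D r)"
      using X arcs by (auto simp: PiE_iff)
    finally show ?thesis
      unfolding alexander_op_def w_def by auto
  qed
  moreover have "dim_row (colouring_matrix D) = ?N" "dim_col (colouring_matrix D) = ?N"
    by (simp_all add: colouring_matrix_def)
  ultimately show ?thesis
    unfolding colourings_eq_arc_colourings solutions_def arc_colourings_def N by auto
qed

section \<open>The number of colourings from a matrix of type II\<close>

lemma num_colourings_eq:
  assumes K: "K \<in> knots" and D: "D \<in> K"
  shows "num_colourings n m K = card (colourings n m D)"
  unfolding num_colourings_def
proof (rule the_equality)
  show "\<forall>E\<in>K. card (colourings n m E) = card (colourings n m D)"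
    using card_arc_colourings_knot[OF K _ D] by (simp add: colourings_eq_arc_colourings)
qed (use D in auto)

text \<open>The two evaluations agree modulo \<open>n\<close>, hence modulo its divisor
  \<open>g\<close>, and a gcd with \<open>g\<close> depends only on the residue modulo
  \<open>g\<close>. This passes from exact evaluations to the reduced ones in the formula.\<close>

lemma gcd_evaluate:
  assumes "g dvd n"
  shows "gcd (evaluate n m p * q) g = gcd (laurent_eval n m p * q) g"
  using cong_dvd_modulus[OF evaluate_cong_laurent_eval assms, of m p]
  by (intro cong_gcd_eq cong_scalar_right)

lemma card_solutions_type_II:
  assumes "type_II A \<alpha>1 \<beta>1 \<alpha>2"
  shows "int (card (solutions A)) =
    n * gcd (evaluate n m \<alpha>2) n *
      gcd (evaluate n m \<beta>1 * (n div gcd (evaluate n m \<alpha>2) n)) (gcd (evaluate n m \<alpha>1) n)"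
proof -
  obtain N where "N \<ge> 3" and A: "A \<in> carrier_mat N N" "upper_triangular A"
    and diag: "diag_mat A = replicate (N - 3) 1 @ [\<alpha>1, \<alpha>2, 0]"
    and rows: "row A (N - 3) = 0\<^sub>v (N - 3) @\<^sub>v vec_of_list [\<alpha>1, \<beta>1, - (\<alpha>1 + \<beta>1)]"
      "row A (N - 2) = 0\<^sub>v (N - 2) @\<^sub>v vec_of_list [\<alpha>2, - \<alpha>2]"
    using assms unfolding type_II_def by blast
  \<comment> \<open>The number of leading diagonal entries equal to 1; the three remaining unknowns
    have indices \<open>k\<close>, \<open>k + 1\<close> and \<open>k + 2\<close>.\<close>
  define k where "k = N - 3"
  have N: "N = k + 3" "N - 3 = k" "N - 2 = Suc k" using \<open>N \<ge> 3\<close> by (auto simp: k_def)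
  define a where "a = (\<lambda>r c. laurent_eval n m (A $$ (r, c)))"
  have entry: "A $$ (r, c) = row A r $ c" if "r < k + 3" "c < k + 3" for r c
    using A(1) that by (simp add: N(1))
  have diag_entry: "A $$ (j, j) = (replicate k 1 @ [\<alpha>1, \<alpha>2, 0]) ! j" if "j < k + 3" for j
    using A(1) that diag[symmetric] by (simp add: N diag_mat_def)
  have "solutions A = triangular_solutions n a (k + 3) 0"
    using A(1) by (auto simp: solutions_def triangular_solutions_def a_def N(1) atLeast0LessThan)
  moreover have "int (card (triangular_solutions n a (k + 3) 0)) =
      n * gcd (laurent_eval n m \<alpha>2) n *
        gcd (laurent_eval n m \<beta>1 * (n div gcd (laurent_eval n m \<alpha>2) n)) (gcd (laurent_eval n m \<alpha>1) n)"
  proof (rule card_triangular_solutions_type_II[OF n_pos])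
    show "a r c = 0" if "c < r" "r < k + 3" for r c
      using A that by (simp add: a_def upper_triangular_def N(1))
    show "a j j = 1" if "j < k" for j
      using that diag_entry[of j] by (simp add: a_def nth_append laurent_eval_unit)
    have "A $$ (k, k + i) = [\<alpha>1, \<beta>1, - (\<alpha>1 + \<beta>1)] ! i" if "i < 3" for i
      using that by (simp add: entry rows(1)[unfolded N(2)] vec_of_list_index del: vec_of_list_Cons)
    from this[of 0] this[of 1] this[of 2]
    show "a k k = laurent_eval n m \<alpha>1" "a k (k + 1) = laurent_eval n m \<beta>1"
      "a k (k + 2) = - (laurent_eval n m \<alpha>1 + laurent_eval n m \<beta>1)"
      by (simp_all add: a_def laurent_eval_add laurent_eval_uminus del: minus_add_distrib)
    have "A $$ (k + 1, k + 1 + i) = [\<alpha>2, - \<alpha>2] ! i" if "i < 2" for i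
      using that by (simp add: entry rows(2)[unfolded N(3)] vec_of_list_index del: vec_of_list_Cons)
    from this[of 0] this[of 1]
    show "a (k + 1) (k + 1) = laurent_eval n m \<alpha>2" "a (k + 1) (k + 2) = - laurent_eval n m \<alpha>2"
      by (simp_all add: a_def laurent_eval_uminus)
    show "a (k + 2) (k + 2) = 0"
      using diag_entry[of "k + 2"] by (simp add: a_def nth_append)
  qed
  ultimately show ?thesis
    using gcd_evaluate[of n \<alpha>1 1] gcd_evaluate[of n \<alpha>2 1] gcd_evaluate[of "gcd (laurent_eval n m \<alpha>1) n" \<beta>1]
    by simp
qed

end

theorem proposition13:
  fixes K :: "gauss_code set" and A C :: "laurent mat"
    and \<alpha>1 \<beta>1 \<alpha>2 :: laurent and n m :: int
  assumes "K \<in> knots"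
    and "is_colouring_matrix K C"
    and "equivalent_to A C"
    and "type_II A \<alpha>1 \<beta>1 \<alpha>2"
    and "n > 0" and "gcd m n = 1"
  shows "int (num_colourings n m K) =
    n * gcd (evaluate n m \<alpha>2) n *
      gcd (evaluate n m \<beta>1 * (n div gcd (evaluate n m \<alpha>2) n)) (gcd (evaluate n m \<alpha>1) n)"
proof -
  interpret alexander n m
    using assms(5,6) by unfold_locales (auto simp: coprime_iff_gcd_eq_1)
  obtain D where D: "D \<in> K" "num_crossings D \<ge> 1" "C = colouring_matrix D"
    using assms(2) by (auto simp: is_colouring_matrix_def)
  have "num_colourings n m K = card (solutions A)"
    using num_colourings_eq[OF assms(1) D(1)] solutions_colouring_matrix[OF D(2)]
      card_solutions_equivalent[OF assms(3)] D(3) by simp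
  then show ?thesis
    using card_solutions_type_II[OF assms(4)] by simp
qed

end
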